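(* Suppose $0<\varepsilon<2$ and let $$\rho_{m,n}=\begin{cases}(-1)^n\phi_m\psi_n/\sigma_n & \text{if } m\le n,\\ (-1)^n\psi_m\phi_n/\sigma_n & \text{if } m>n,\end{cases}\qquad m,n\in\mathbf{Z}_+ .$$ Then $\rho\in l^2(\mathbf{Z}_+\times\mathbf{Z}_+)$. The Hilbert-Schmidt operator $R$ on $l^2(\mathbf{Z}_+)$ defined by $(Rf)_m=\sum_{n=1}^\infty\rho_{m,n}f_n$ satisfies $A_+Rf=f$ for all $f\in l^2(\mathbf{Z}_+)$ (in particular $Rf$ lies in the domain of $A_+$). Indeed $0\notin\mathrm{Spec}(A_+)$ and $R=A_+^{-1}$.
   Context: Let $\mathbf{Z}_+=\{1,2,3,\dots\}$ and let $l^2(\mathbf{Z}_+)$ be the usual complex Hilbert space of square-summable sequences. $A_+$ is the (unbounded, closed) operator on $l^2(\mathbf{Z}_+)$ given by $$(A_+v)_n=\frac{\varepsilon}{2}\,n(n-1)\,v_{n-1}-\frac{\varepsilon}{2}\,n(n+1)\,v_{n+1}+n\,v_n,\qquad n\ge 1,$$ where for $n=1$ the first term is $0$, with its natural maximal domain, i.e. the set of all $v\in l^2(\mathbf{Z}_+)$ for which the sequence $A_+v$ defined by this formula belongs to $l^2(\mathbf{Z}_+)$. The sequences $\phi,\psi,\sigma$ are defined as follows. (i) $\phi=(\phi_n)_{n\ge1}$ is the solution of $\phi_n=\frac{n-2}{n}\phi_{n-2}+\frac{2}{\varepsilon n}\phi_{n-1}$ ($n\ge 3$) with initial conditions $\phi_1=1$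 and $\phi_2=\varepsilon^{-1}$. (ii) $\psi_n=(-1)^nw_n$ ($n\ge1$) is the unique solution of $\psi_n=\frac{n-2}{n}\psi_{n-2}+\frac{2}{\varepsilon n}\psi_{n-1}$ ($n\ge3$) such that $\lim_{n\to+\infty}n^cw_n=1$, where $c=1+1/\varepsilon$. (Equivalently, $w_n=\frac{n+2}{n}w_{n+2}+\frac{2}{\varepsilon n}w_{n+1}$ for all $n\ge1$.) (iii) For $n\ge1$, $$\sigma_n=\frac{\varepsilon}{2}n(n-1)\phi_{n-1}w_n+\frac{\varepsilon}{2}n(n+1)\phi_nw_{n+1}+n\phi_nw_n,$$ where for $n=1$ the first term is $0$. One has $\phi_n>0$, $w_n>0$ and hence $\sigma_n>0$ for all $n\ge1$, so that $\rho_{m,n}$ is well defined. *)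

theory Defs
  imports "HOL-Analysis.Analysis"
begin

text \<open>
  An element of \<open>l\<^sup>2(I)\<close> is represented by a function on the whole index type that vanishes
  outside \<open>I\<close>, so that equality of functions is equality of vectors.
\<close>

definition ell2 :: "'i set \<Rightarrow> ('i \<Rightarrow> complex) set" where
  "ell2 I = {f. (\<forall>i. i \<notin> I \<longrightarrow> f i = 0) \<and> (\<lambda>i. (cmod (f i))\<^sup>2) summable_on I}"

definition ell2_norm :: "'i set \<Rightarrow> ('i \<Rightarrow> complex) \<Rightarrow> real" where
  "ell2_norm I f = sqrt (\<Sum>\<^sub>\<infinity>i\<in>I. (cmod (f i))\<^sup>2)"

definition bounded_op :: "'i set \<Rightarrow> (('i \<Rightarrow> complex) \<Rightarrow> ('i \<Rightarrow> complex)) \<Rightarrow> bool" where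
  "bounded_op I B \<longleftrightarrow>
     (\<forall>f\<in>ell2 I. B f \<in> ell2 I) \<and>
     (\<forall>f\<in>ell2 I. \<forall>g\<in>ell2 I. B (\<lambda>i. f i + g i) = (\<lambda>i. B f i + B g i)) \<and>
     (\<forall>f\<in>ell2 I. \<forall>c. B (\<lambda>i. c * f i) = (\<lambda>i. c * B f i)) \<and>
     (\<exists>C. \<forall>f\<in>ell2 I. ell2_norm I (B f) \<le> C * ell2_norm I f)"

text \<open>The Hilbert-Schmidt norm is independent of the orthonormal basis; the standard one is used.\<close>

definition hilbert_schmidt :: "'i set \<Rightarrow> (('i \<Rightarrow> complex) \<Rightarrow> ('i \<Rightarrow> complex)) \<Rightarrow> bool" where
  "hilbert_schmidt I B \<longleftrightarrow>
     bounded_op I B \<and>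
     (\<lambda>j. (ell2_norm I (B (\<lambda>i. if i = j then 1 else 0)))\<^sup>2) summable_on I"

text \<open>
  An unbounded linear operator in \<open>l\<^sup>2(I)\<close> is given by its domain \<open>D\<close> and its action \<open>T\<close>,
  of which only the values on \<open>D\<close> matter.
\<close>

definition is_inverse_op ::
  "'i set \<Rightarrow> ('i \<Rightarrow> complex) set \<Rightarrow> (('i \<Rightarrow> complex) \<Rightarrow> ('i \<Rightarrow> complex)) \<Rightarrow>
   (('i \<Rightarrow> complex) \<Rightarrow> ('i \<Rightarrow> complex)) \<Rightarrow> bool" where
  "is_inverse_op I D T B \<longleftrightarrow>
     (\<forall>v\<in>D. T v \<in> ell2 I \<and> B (T v) = v) \<and>
     (\<forall>f\<in>ell2 I. B f \<in> D \<and> T (B f) = f)"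

definition op_spectrum ::
  "'i set \<Rightarrow> ('i \<Rightarrow> complex) set \<Rightarrow> (('i \<Rightarrow> complex) \<Rightarrow> ('i \<Rightarrow> complex)) \<Rightarrow> complex set" where
  "op_spectrum I D T =
     {z. \<not> (\<exists>B. bounded_op I B \<and> is_inverse_op I D (\<lambda>v i. T v i - z * v i) B)}"

definition kernel_op :: "'i set \<Rightarrow> ('i \<Rightarrow> 'i \<Rightarrow> complex) \<Rightarrow> ('i \<Rightarrow> complex) \<Rightarrow> ('i \<Rightarrow> complex)" where
  "kernel_op I k f = (\<lambda>m. if m \<in> I then (\<Sum>\<^sub>\<infinity>n\<in>I. k m n * f n) else 0)"

abbreviation Zpos :: "nat set" where
  "Zpos \<equiv> {1..}"

text \<open>
  In the formula for the operator \<open>A\<^sub>+\<close> all terms vanish at \<open>n = 0\<close>, and the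
  first one vanishes at \<open>n = 1\<close>.
\<close>

definition A_plus :: "real \<Rightarrow> (nat \<Rightarrow> complex) \<Rightarrow> (nat \<Rightarrow> complex)" where
  "A_plus \<epsilon> v = (\<lambda>n.
       of_real (\<epsilon> / 2 * real n * (real n - 1)) * v (n - 1)
     - of_real (\<epsilon> / 2 * real n * (real n + 1)) * v (n + 1)
     + of_nat n * v n)"

definition A_plus_dom :: "real \<Rightarrow> (nat \<Rightarrow> complex) set" where
  "A_plus_dom \<epsilon> = {v \<in> ell2 Zpos. A_plus \<epsilon> v \<in> ell2 Zpos}"

text \<open>
  The sequences \<open>\<phi>\<close> and \<open>\<psi>\<close> are indexed by \<open>n \<ge> 1\<close>; their value at \<open>0\<close>
  is set to \<open>0\<close>. For \<open>\<psi>\<close> this makes the description unique.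
\<close>

fun phi :: "real \<Rightarrow> nat \<Rightarrow> real" where
  "phi \<epsilon> n =
     (if n = 0 then 0
      else if n = 1 then 1
      else if n = 2 then 1 / \<epsilon>
      else (real n - 2) / real n * phi \<epsilon> (n - 2) + 2 / (\<epsilon> * real n) * phi \<epsilon> (n - 1))"

declare phi.simps [simp del]

definition psi :: "real \<Rightarrow> nat \<Rightarrow> real" where
  "psi \<epsilon> = (THE p. p 0 = 0 \<and>
     (\<forall>n\<ge>3. p n = (real n - 2) / real n * p (n - 2) + 2 / (\<epsilon> * real n) * p (n - 1)) \<and>
     (\<lambda>n. real n powr (1 + 1 / \<epsilon>) * ((-1) ^ n * p n)) \<longlonglongrightarrow> 1)"

definition w :: "real \<Rightarrow> nat \<Rightarrow> real" where
  "w \<epsilon> n = (-1) ^ n * psi \<epsilon> n"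

definition sigma :: "real \<Rightarrow> nat \<Rightarrow> real" where
  "sigma \<epsilon> n =
     \<epsilon> / 2 * real n * (real n - 1) * phi \<epsilon> (n - 1) * w \<epsilon> n
   + \<epsilon> / 2 * real n * (real n + 1) * phi \<epsilon> n * w \<epsilon> (n + 1)
   + real n * phi \<epsilon> n * w \<epsilon> n"

text \<open>If \<open>m = 0\<close> or \<open>n = 0\<close>, then \<open>\<rho>\<close> is \<open>0\<close> because \<open>\<phi>\<close> is \<open>0\<close> at \<open>0\<close>.\<close>

definition rho :: "real \<Rightarrow> nat \<Rightarrow> nat \<Rightarrow> real" where
  "rho \<epsilon> m n =
     (if m \<le> n then (-1) ^ n * phi \<epsilon> m * psi \<epsilon> n / sigma \<epsilon> n
      else (-1) ^ n * psi \<epsilon> m * phi \<epsilon> n / sigma \<epsilon> n)"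

definition R_op :: "real \<Rightarrow> (nat \<Rightarrow> complex) \<Rightarrow> (nat \<Rightarrow> complex)" where
  "R_op \<epsilon> = kernel_op Zpos (\<lambda>m n. of_real (rho \<epsilon> m n))"

end

theory Submission imports Defs begin

text \<open>
  Put \<open>a = 1 / \<epsilon>\<close>. Dividing by \<open>\<epsilon> n / 2\<close>, the equation \<open>A\<^sub>+ v = 0\<close> at \<open>n\<close> reads
  \<open>(n + 1) v (n + 1) = (n - 1) v (n - 1) + 2 a v n\<close>, and \<open>\<rho>\<close> is the Green kernel built from its
  two solutions: \<open>\<phi>\<close>, which satisfies the boundary condition at \<open>n = 1\<close>, and the decaying
  solution \<open>\<psi>\<close>.

  The solution \<open>\<psi>\<close> exists because the moments
  \<open>\<integral> t^(n-1) ((1 - t) / (1 + t))^a dt\<close> over the unit interval satisfy the recurrence up to signs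
  (integrate by parts), and a comparison with Beta integrals shows that they are asymptotic to a
  constant times \<open>n^(-1-a)\<close>. All further estimates come from one conserved quantity: the
  Casorati determinant \<open>n (n + 1) (x (n+1) y n - x n y (n+1))\<close> of two solutions has
  constant modulus (\<open>casoratian_alternates\<close>). It yields

  \<^item> the uniqueness of \<open>\<psi>\<close> (\<open>alternating_solution_unique\<close>);
  \<^item> that \<open>\<sigma>\<close> does not depend on \<open>n\<close> (\<open>sigma_constant\<close>);
  \<^item> the bound \<open>\<phi> n \<le> C n^(a-1)\<close> from the lower bound on \<open>w\<close>, hence
    \<open>\<bar>\<rho> m n\<bar> \<le> C / (m n)\<close> (\<open>abs_rho_le\<close>);
  \<^item> the lower bound \<open>\<phi> n + \<phi> (n + 1) \<ge> c n^(a-1)\<close>, hence \<open>\<phi>\<close> is not square-summable if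
    \<open>a > 1/2\<close> (\<open>phi_not_square_summable\<close>).

  The kernel is thus dominated by a product of square-summable functions, so \<open>R\<close> is a
  Hilbert-Schmidt operator. The identity \<open>A\<^sub>+ R f = f\<close> is variation of constants
  (\<open>A_plus_R_op\<close>). Conversely, for \<open>v\<close> in the domain, \<open>R A\<^sub>+ v - v\<close> lies in the kernel of
  \<open>A\<^sub>+\<close>, which as a space of sequences is spanned by \<open>\<phi>\<close>; since \<open>\<phi>\<close> is not in \<open>l\<^sup>2\<close> for
  \<open>\<epsilon> < 2\<close>, the difference is \<open>0\<close>.
\<close>

section \<open>Kernels dominated by a product\<close>

lemma infsum_Cauchy_Schwarz:
  fixes f g :: "'i \<Rightarrow> real"
  assumes f: "(\<lambda>i. (f i)\<^sup>2) summable_on I" and g: "(\<lambda>i. (g i)\<^sup>2) summable_on I"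
  shows "(\<lambda>i. \<bar>f i * g i\<bar>) summable_on I"
    and "(\<Sum>\<^sub>\<infinity>i\<in>I. \<bar>f i * g i\<bar>) \<le> sqrt (\<Sum>\<^sub>\<infinity>i\<in>I. (f i)\<^sup>2) * sqrt (\<Sum>\<^sub>\<infinity>i\<in>I. (g i)\<^sup>2)"
proof -
  show summable: "(\<lambda>i. \<bar>f i * g i\<bar>) summable_on I"
    using abs_summable_product[of f I g] f g by (simp add: power2_eq_square)
  show "(\<Sum>\<^sub>\<infinity>i\<in>I. \<bar>f i * g i\<bar>) \<le> sqrt (\<Sum>\<^sub>\<infinity>i\<in>I. (f i)\<^sup>2) * sqrt (\<Sum>\<^sub>\<infinity>i\<in>I. (g i)\<^sup>2)"
  proof (rule infsum_le_finite_sums[OF summable])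
    fix F assume F: "finite F" "F \<subseteq> I"
    have "(\<Sum>i\<in>F. \<bar>f i * g i\<bar>) \<le> L2_set f F * L2_set g F"
      using L2_set_mult_ineq[of f g F] by (simp add: abs_mult)
    also have "\<dots> \<le> sqrt (\<Sum>\<^sub>\<infinity>i\<in>I. (f i)\<^sup>2) * sqrt (\<Sum>\<^sub>\<infinity>i\<in>I. (g i)\<^sup>2)"
      unfolding L2_set_def using F f g
      by (intro mult_mono real_sqrt_le_mono finite_sum_le_infsum) (auto intro: sum_nonneg infsum_nonneg)
    finally show "(\<Sum>i\<in>F. \<bar>f i * g i\<bar>) \<le> \<dots>" .
  qed
qed

lemma ell2_square_summable: "f \<in> ell2 I \<Longrightarrow> (\<lambda>i. (cmod (f i))\<^sup>2) summable_on I"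
  by (simp add: ell2_def)

lemma ell2_lincomb:
  assumes "f \<in> ell2 I" "g \<in> ell2 I"
  shows "(\<lambda>i. f i + c * g i) \<in> ell2 I"
proof -
  have "(\<lambda>i. 2 * (cmod (f i))\<^sup>2 + (2 * (cmod c)\<^sup>2) * (cmod (g i))\<^sup>2) summable_on I"
    using assms by (intro summable_on_add summable_on_cmult_right ell2_square_summable)
  hence "(\<lambda>i. (cmod (f i + c * g i))\<^sup>2) summable_on I"
  proof (rule summable_on_comparison_test)
    fix i
    have "(cmod (f i + c * g i))\<^sup>2 \<le> (cmod (f i) + cmod (c * g i))\<^sup>2"
      by (intro power_mono norm_triangle_ineq) auto
    also have "\<dots> \<le> 2 * (cmod (f i))\<^sup>2 + 2 * (cmod (c * g i))\<^sup>2"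
      using sum_squares_bound[of "cmod (f i)" "cmod (c * g i)"] by (simp add: power2_sum)
    finally show "(cmod (f i + c * g i))\<^sup>2 \<le> 2 * (cmod (f i))\<^sup>2 + (2 * (cmod c)\<^sup>2) * (cmod (g i))\<^sup>2"
      by (simp add: norm_mult power_mult_distrib)
  qed auto
  thus ?thesis using assms by (auto simp: ell2_def)
qed

lemma ell2_norm_dominated:
  assumes g: "(\<lambda>i. (g i)\<^sup>2) summable_on I" and C: "C \<ge> 0"
    and "\<And>i. i \<notin> I \<Longrightarrow> f i = 0"
    and le: "\<And>i. i \<in> I \<Longrightarrow> cmod (f i) \<le> C * g i"
  shows "f \<in> ell2 I" and "ell2_norm I f \<le> C * sqrt (\<Sum>\<^sub>\<infinity>i\<in>I. (g i)\<^sup>2)"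
proof -
  have le2: "(cmod (f i))\<^sup>2 \<le> C\<^sup>2 * (g i)\<^sup>2" if "i \<in> I" for i
    using power_mono[OF le[OF that], of 2] by (simp add: power_mult_distrib)
  have sum: "(\<lambda>i. C\<^sup>2 * (g i)\<^sup>2) summable_on I"
    using g by (rule summable_on_cmult_right)
  hence sumf: "(\<lambda>i. (cmod (f i))\<^sup>2) summable_on I"
    by (rule summable_on_comparison_test) (auto simp: le2)
  thus "f \<in> ell2 I" using assms by (auto simp: ell2_def)
  have "(\<Sum>\<^sub>\<infinity>i\<in>I. (cmod (f i))\<^sup>2) \<le> (\<Sum>\<^sub>\<infinity>i\<in>I. C\<^sup>2 * (g i)\<^sup>2)"
    by (rule infsum_mono[OF sumf sum le2])
  hence "sqrt (\<Sum>\<^sub>\<infinity>i\<in>I. (cmod (f i))\<^sup>2) \<le> sqrt (C\<^sup>2 * (\<Sum>\<^sub>\<infinity>i\<in>I. (g i)\<^sup>2))"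
    by (simp add: infsum_cmult_right')
  thus "ell2_norm I f \<le> C * sqrt (\<Sum>\<^sub>\<infinity>i\<in>I. (g i)\<^sup>2)"
    using C by (simp add: ell2_norm_def real_sqrt_mult)
qed

text \<open>
  A kernel dominated by a product \<open>g i * h j\<close> of square-summable functions is handled by the
  Cauchy-Schwarz inequality alone: every value \<open>(K f) i\<close> is at most \<open>g i\<close> times a constant that
  depends on \<open>f\<close> only, and for a basis vector \<open>f = e\<^sub>j\<close> this constant is \<open>\<bar>h j\<bar>\<close>.
\<close>

context
  fixes I :: "'i set" and k :: "'i \<Rightarrow> 'i \<Rightarrow> complex" and g h :: "'i \<Rightarrow> real"
  assumes g: "(\<lambda>i. (g i)\<^sup>2) summable_on I" and h: "(\<lambda>i. (h i)\<^sup>2) summable_on I"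
    and g_nonneg: "\<And>i. i \<in> I \<Longrightarrow> g i \<ge> 0"
    and k_le: "\<And>i j. i \<in> I \<Longrightarrow> j \<in> I \<Longrightarrow> cmod (k i j) \<le> g i * h j"
begin

lemma dominated_kernel_square_summable: "(\<lambda>(i, j). (cmod (k i j))\<^sup>2) summable_on I \<times> I"
proof -
  have "(\<lambda>(i, j). (g i)\<^sup>2 * (h j)\<^sup>2) summable_on I \<times> I"
  proof (rule summable_on_SigmaI)
    show "((\<lambda>j. case (i, j) of (i, j) \<Rightarrow> (g i)\<^sup>2 * (h j)\<^sup>2) has_sum (g i)\<^sup>2 * (\<Sum>\<^sub>\<infinity>j\<in>I. (h j)\<^sup>2)) I" for i
      using h by (auto intro: has_sum_cmult_right has_sum_infsum)
    show "(\<lambda>i. (g i)\<^sup>2 * (\<Sum>\<^sub>\<infinity>j\<in>I. (h j)\<^sup>2)) summable_on I"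
      using g by (rule summable_on_cmult_left)
  qed auto
  thus ?thesis
  proof (rule summable_on_comparison_test)
    fix p assume "p \<in> I \<times> I"
    thus "(case p of (i, j) \<Rightarrow> (cmod (k i j))\<^sup>2) \<le> (case p of (i, j) \<Rightarrow> (g i)\<^sup>2 * (h j)\<^sup>2)"
      using power_mono[OF k_le, of "fst p" "snd p" 2] by (auto simp: power_mult_distrib)
  qed auto
qed

lemma dominated_kernel_term_bound:
  assumes i: "i \<in> I" and j: "j \<in> I"
  shows "cmod (k i j * c) \<le> g i * \<bar>h j * cmod c\<bar>"
proof -
  have "cmod (k i j * c) \<le> g i * h j * cmod c"
    unfolding norm_mult by (intro mult_right_mono k_le i j) auto
  also have "\<dots> \<le> g i * \<bar>h j * cmod c\<bar>"
    using g_nonneg[OF i] by (simp add: mult.assoc mult_left_mono)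
  finally show ?thesis .
qed

lemma dominated_kernel_abs_summable:
  assumes f: "f \<in> ell2 I" and i: "i \<in> I"
  shows "(\<lambda>j. cmod (k i j * f j)) summable_on I"
proof -
  have "(\<lambda>j. g i * \<bar>h j * cmod (f j)\<bar>) summable_on I"
    by (intro summable_on_cmult_right infsum_Cauchy_Schwarz(1) h ell2_square_summable f)
  thus ?thesis
  proof (rule summable_on_comparison_test)
    fix j assume j: "j \<in> I"
    show "cmod (k i j * f j) \<le> g i * \<bar>h j * cmod (f j)\<bar>"
      by (rule dominated_kernel_term_bound[OF i j])
  qed auto
qed

lemma dominated_kernel_pointwise_bound:
  assumes f: "f \<in> ell2 I" and i: "i \<in> I"
  shows "cmod (kernel_op I k f i) \<le> (\<Sum>\<^sub>\<infinity>j\<in>I. \<bar>h j * cmod (f j)\<bar>) * g i"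
proof -
  note hf = infsum_Cauchy_Schwarz(1)[OF h ell2_square_summable[OF f]]
  have "cmod (kernel_op I k f i) \<le> (\<Sum>\<^sub>\<infinity>j\<in>I. cmod (k i j * f j))"
    unfolding kernel_op_def using i dominated_kernel_abs_summable[OF f i]
    by (simp add: norm_infsum_bound)
  also have "\<dots> \<le> (\<Sum>\<^sub>\<infinity>j\<in>I. g i * \<bar>h j * cmod (f j)\<bar>)"
  proof (rule infsum_mono)
    fix j assume j: "j \<in> I"
    show "cmod (k i j * f j) \<le> g i * \<bar>h j * cmod (f j)\<bar>"
      by (rule dominated_kernel_term_bound[OF i j])
  qed (use dominated_kernel_abs_summable[OF f i] hf in \<open>auto intro: summable_on_cmult_right\<close>)
  finally show ?thesis by (simp add: infsum_cmult_right' mult.commute)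
qed

lemma dominated_kernel_norm_bound:
  assumes f: "f \<in> ell2 I"
  shows "kernel_op I k f \<in> ell2 I"
    and "ell2_norm I (kernel_op I k f)
           \<le> (\<Sum>\<^sub>\<infinity>j\<in>I. \<bar>h j * cmod (f j)\<bar>) * sqrt (\<Sum>\<^sub>\<infinity>i\<in>I. (g i)\<^sup>2)"
proof -
  have "(\<Sum>\<^sub>\<infinity>j\<in>I. \<bar>h j * cmod (f j)\<bar>) \<ge> 0" by (intro infsum_nonneg) auto
  note * = ell2_norm_dominated[OF g this, of "kernel_op I k f",
      OF _ dominated_kernel_pointwise_bound[OF f]]
  show "kernel_op I k f \<in> ell2 I"
    and "ell2_norm I (kernel_op I k f)
           \<le> (\<Sum>\<^sub>\<infinity>j\<in>I. \<bar>h j * cmod (f j)\<bar>) * sqrt (\<Sum>\<^sub>\<infinity>i\<in>I. (g i)\<^sup>2)"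
    by (intro *; simp add: kernel_op_def)+
qed

lemma dominated_kernel_bounded_op: "bounded_op I (kernel_op I k)"
  unfolding bounded_op_def
proof (intro conjI ballI allI exI)
  fix f assume f: "f \<in> ell2 I"
  show "kernel_op I k f \<in> ell2 I" by (rule dominated_kernel_norm_bound[OF f])
  note summable = abs_summable_summable[OF dominated_kernel_abs_summable]
  show "kernel_op I k (\<lambda>i. f i + g i) = (\<lambda>i. kernel_op I k f i + kernel_op I k g i)"
    if "g \<in> ell2 I" for g
    using f that by (auto simp: kernel_op_def fun_eq_iff distrib_left infsum_add summable)
  show "kernel_op I k (\<lambda>i. c * f i) = (\<lambda>i. c * kernel_op I k f i)" for c
    by (auto simp: kernel_op_def fun_eq_iff infsum_cmult_right'[symmetric] mult.left_commute)
  have "ell2_norm I (kernel_op I k f) \<le> (\<Sum>\<^sub>\<infinity>j\<in>I. \<bar>h j * cmod (f j)\<bar>) * sqrt (\<Sum>\<^sub>\<infinity>i\<in>I. (g i)\<^sup>2)"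
    by (rule dominated_kernel_norm_bound[OF f])
  also have "\<dots> \<le> (sqrt (\<Sum>\<^sub>\<infinity>j\<in>I. (h j)\<^sup>2) * ell2_norm I f) * sqrt (\<Sum>\<^sub>\<infinity>i\<in>I. (g i)\<^sup>2)"
    unfolding ell2_norm_def
    by (intro mult_right_mono infsum_Cauchy_Schwarz(2) h ell2_square_summable f) (auto intro: infsum_nonneg)
  finally show "ell2_norm I (kernel_op I k f)
      \<le> (sqrt (\<Sum>\<^sub>\<infinity>j\<in>I. (h j)\<^sup>2) * sqrt (\<Sum>\<^sub>\<infinity>i\<in>I. (g i)\<^sup>2)) * ell2_norm I f"
    by (simp add: mult_ac)
qed

lemma dominated_kernel_hilbert_schmidt: "hilbert_schmidt I (kernel_op I k)"
  unfolding hilbert_schmidt_def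
proof
  have "(\<lambda>j. (sqrt (\<Sum>\<^sub>\<infinity>i\<in>I. (g i)\<^sup>2))\<^sup>2 * (h j)\<^sup>2) summable_on I"
    using h by (rule summable_on_cmult_right)
  thus "(\<lambda>j. (ell2_norm I (kernel_op I k (\<lambda>i. if i = j then 1 else 0)))\<^sup>2) summable_on I"
  proof (rule summable_on_comparison_test)
    fix j assume j: "j \<in> I"
    define e where "e = (\<lambda>i. if i = j then 1 else 0 :: complex)"
    have single: "((\<lambda>i. if i = j then c else 0) has_sum c) I" for c :: real
      using j has_sum_finite[of "{j}" "\<lambda>i. if i = j then c else 0"]
      by (subst has_sum_cong_neutral[of "{j}"]) auto
    have "(\<lambda>i. (cmod (e i))\<^sup>2) = (\<lambda>i. if i = j then 1 else 0)" by (auto simp: e_def)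
    hence e: "e \<in> ell2 I"
      using single[of 1] j by (auto simp: ell2_def e_def summable_on_def)
    have "(\<lambda>i. \<bar>h i * cmod (e i)\<bar>) = (\<lambda>i. if i = j then \<bar>h j\<bar> else 0)" by (auto simp: e_def)
    hence "(\<Sum>\<^sub>\<infinity>i\<in>I. \<bar>h i * cmod (e i)\<bar>) = \<bar>h j\<bar>"
      using single by (auto intro: infsumI)
    hence "ell2_norm I (kernel_op I k e) \<le> \<bar>h j\<bar> * sqrt (\<Sum>\<^sub>\<infinity>i\<in>I. (g i)\<^sup>2)"
      using dominated_kernel_norm_bound(2)[OF e] by simp
    moreover have "ell2_norm I (kernel_op I k e) \<ge> 0"
      by (auto simp: ell2_norm_def intro: infsum_nonneg)
    ultimately have "(ell2_norm I (kernel_op I k e))\<^sup>2 \<le> (\<bar>h j\<bar> * sqrt (\<Sum>\<^sub>\<infinity>i\<in>I. (g i)\<^sup>2))\<^sup>2"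
      by (intro power_mono)
    thus "(ell2_norm I (kernel_op I k (\<lambda>i. if i = j then 1 else 0)))\<^sup>2
        \<le> (sqrt (\<Sum>\<^sub>\<infinity>i\<in>I. (g i)\<^sup>2))\<^sup>2 * (h j)\<^sup>2"
      by (simp add: power_mult_distrib mult.commute e_def)
  qed auto
qed (rule dominated_kernel_bounded_op)

end

section \<open>Moments of the weight ((1 - t) / (1 + t)) powr a\<close>

text \<open>Up to a factor that tends to \<open>1\<close>, the left-hand side is Gauss's product for \<open>\<Gamma>(b)\<close>.\<close>

lemma Beta_nat_asymptotics:
  fixes b :: real
  assumes "b > 0"
  shows "(\<lambda>n. real n powr b * Beta (real n) b) \<longlonglongrightarrow> Gamma b"
proof -
  have "real n powr b * Beta (real n) b = Gamma_series b n * (b / real n + 1)" if n: "n > 0" for n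
  proof -
    obtain m where m: "n = Suc m" using n by (cases n) auto
    have "pochhammer b n = Gamma (b + real n) / Gamma b"
      using assms by (intro pochhammer_Gamma) (auto elim!: nonpos_Ints_cases)
    hence "Beta (real n) b = fact m / pochhammer b n"
      using Gamma_fact[of m, where 'a=real] m by (simp add: Beta_def add_ac)
    moreover have "Gamma_series b n = real n * (fact m / pochhammer b n) * real n powr b / (b + real n)"
      using n by (simp add: Gamma_series_def pochhammer_Suc powr_def m)
    moreover have "b / real n + 1 = (b + real n) / real n" "b + real n \<noteq> 0"
      using n assms by (simp_all add: add_divide_distrib)
    ultimately show ?thesis using n by simp
  qed
  hence "eventually (\<lambda>n. Gamma_series b n * (b / real n + 1) = real n powr b * Beta (real n) b) sequentially"
    by (intro eventually_mono[OF eventually_gt_at_top[of 0]]) simp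
  moreover have "(\<lambda>n. Gamma_series b n * (b / real n + 1)) \<longlonglongrightarrow> Gamma b * (0 + 1)"
    by (intro tendsto_intros lim_const_over_n)
  ultimately show ?thesis
    by (auto intro: Lim_transform_eventually)
qed

text \<open>
  The moments of the weight \<open>((1 - t) / (1 + t)) powr a\<close> on the unit interval. The weight
  solves \<open>(1 - t\<^sup>2) g' = - 2 a g\<close> and vanishes at \<open>1\<close>, which is what turns
  \<open>d/dt ((1 - t\<^sup>2) t^(n-1) g)\<close> into a three-term recurrence for the moments. The index is shifted so
  that \<open>n = 1\<close> gives the integral of the weight; the value at \<open>n = 0\<close> is a default.
\<close>

definition moebius_moment :: "real \<Rightarrow> nat \<Rightarrow> real" where
  "moebius_moment a n = integral {0..1} (\<lambda>t. t ^ (n - 1) * ((1 - t) powr a * (1 + t) powr (- a)))"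

lemma moebius_moment_integrable:
  assumes "a > 0"
  shows "(\<lambda>t. t ^ k * ((1 - t) powr a * (1 + t) powr (- a))) integrable_on {0..1::real}"
  using assms by (intro integrable_continuous_interval continuous_intros continuous_on_powr') auto

text \<open>
  Integrate the derivative of \<open>t^(n-1) (1 - t\<^sup>2) ((1 - t) / (1 + t)) powr a\<close> over the unit interval.
  The boundary term at \<open>0\<close> disappears only if \<open>n \<ge> 2\<close>.
\<close>

lemma moebius_moment_recurrence:
  assumes a: "a > 0" and n: "n \<ge> 2"
  shows "(real n + 1) * moebius_moment a (n + 1) =
         (real n - 1) * moebius_moment a (n - 1) - 2 * a * moebius_moment a n"
proof -
  define g :: "real \<Rightarrow> real" where "g = (\<lambda>t. (1 - t) powr a * (1 + t) powr (- a))"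
  define F where "F = (\<lambda>t::real. t ^ (n - 1) * ((1 - t) powr (a + 1) * (1 + t) powr (1 - a)))"
  define F' where "F' = (\<lambda>t. (real n - 1) * (t ^ (n - 2) * g t) - 2 * a * (t ^ (n - 1) * g t)
                          - (real n + 1) * (t ^ n * g t))"
  obtain k where k: "n = k + 2" using n by (metis add.commute le_Suc_ex)
  have I: "(\<lambda>t. t ^ j * g t) integrable_on {0..1}" for j
    using moebius_moment_integrable[OF a] by (simp add: g_def)
  have M: "moebius_moment a j = integral {0..1} (\<lambda>t. t ^ (j - 1) * g t)" for j
    by (simp add: moebius_moment_def g_def)
  have "(F' has_integral F 1 - F 0) {0..1}"
  proof (rule fundamental_theorem_of_calculus_interior)
    show "continuous_on {0..1} F"
      unfolding F_def using a by (intro continuous_intros continuous_on_powr') auto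
    fix t :: real assume t: "t \<in> {0<..<1}"
    have "(F has_real_derivative
        (real n - 1) * t ^ (n - 2) * ((1 - t) powr (a + 1) * (1 + t) powr (1 - a))
        + t ^ (n - 1) * ((1 - t) powr (a + 1) * ((1 - a) * (1 + t) powr (- a))
                         - (a + 1) * (1 - t) powr a * (1 + t) powr (1 - a))) (at t)"
    proof -
      have p: "((\<lambda>t. t ^ (n - 1)) has_real_derivative (real n - 1) * t ^ (n - 2)) (at t)"
        using DERIV_pow[of "n - 1" t] by (simp add: k add.commute)
      have q: "((\<lambda>t. (1 - t) powr (a + 1)) has_real_derivative - ((a + 1) * (1 - t) powr a)) (at t)"
        using t by (auto intro!: derivative_eq_intros simp: powr_diff)
      have r: "((\<lambda>t. (1 + t) powr (1 - a)) has_real_derivative (1 - a) * (1 + t) powr (- a)) (at t)"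
        using DERIV_fun_powr[of "\<lambda>t. 1 + t" 1 t "1 - a"] t by (auto intro!: derivative_eq_intros)
      show ?thesis
        unfolding F_def using DERIV_mult[OF p DERIV_mult[OF q r]] by (simp add: algebra_simps)
    qed
    also have "(1 - t) powr (a + 1) = (1 - t) * (1 - t) powr a"
      using t by (simp add: powr_add)
    also have "(1 + t) powr (1 - a) = (1 + t) * (1 + t) powr (- a)"
      using t powr_add[of "1 + t" 1 "- a"] by simp
    also have "(real n - 1) * t ^ (n - 2) *
        ((1 - t) * (1 - t) powr a * ((1 + t) * (1 + t) powr - a)) +
      t ^ (n - 1) * ((1 - t) * (1 - t) powr a * ((1 - a) * (1 + t) powr - a) -
        (a + 1) * (1 - t) powr a * ((1 + t) * (1 + t) powr - a)) = F' t"
      by (simp add: F'_def g_def k algebra_simps)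
    finally show "(F has_vector_derivative F' t) (at t)"
      by (simp add: has_real_derivative_iff_has_vector_derivative)
  qed simp
  hence "integral {0..1} F' = 0"
    using n by (auto simp: F_def dest!: integral_unique)
  moreover have "integral {0..1} F' =
      (real n - 1) * moebius_moment a (n - 1) - 2 * a * moebius_moment a n
      - (real n + 1) * moebius_moment a (n + 1)"
    unfolding F'_def M
    by (subst Henstock_Kurzweil_Integration.integral_diff
       | intro integrable_diff integrable_on_mult_right I | simp add: k)+
  ultimately show ?thesis by simp
qed

text \<open>
  For large \<open>n\<close> the factor \<open>t^(n-1)\<close> concentrates the moment at \<open>t = 1\<close>, where
  \<open>(1 + t) powr (-a)\<close> equals \<open>2 powr (-a)\<close>. The error of replacing it by this constant is linear in
  \<open>1 - t\<close>, so it contributes a Beta integral whose second argument is larger by one, which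
  is smaller by a factor \<open>1 / n\<close>.
\<close>

lemma moebius_weight_upper_bound:
  fixes a t :: real
  assumes "a > 0" "0 \<le> t" "t \<le> 1"
  shows "(1 + t) powr (- a) \<le> 2 powr (- a) * (1 + a * exp a * (1 - t))"
proof -
  define s where "s = 1 - t"
  have s: "0 \<le> s" "s \<le> 1" using assms by (auto simp: s_def)
  have "0 \<le> t * (1 - t)" using assms by simp
  hence "2 / (1 + t) \<le> 1 + s" using assms by (simp add: s_def field_simps)
  also have "\<dots> \<le> exp s" by (rule exp_ge_add_one_self)
  finally have "(2 / (1 + t)) powr a \<le> exp s powr a"
    using assms by (intro powr_mono2) auto
  also have "\<dots> = exp (a * s)" by (simp add: exp_powr_real mult.commute)
  also have "\<dots> \<le> 1 + a * s * exp (a * s)"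
  proof -
    have "(1 + - (a * s)) * exp (a * s) \<le> exp (- (a * s)) * exp (a * s)"
      by (intro mult_right_mono exp_ge_add_one_self) auto
    thus ?thesis by (simp add: exp_minus algebra_simps)
  qed
  also have "a * s * exp (a * s) \<le> a * s * exp a"
    using assms s by (intro mult_left_mono) (auto simp: mult_left_le)
  finally have "(2 / (1 + t)) powr a \<le> 1 + a * exp a * s" by (simp add: mult_ac)
  hence "2 powr (- a) * (2 / (1 + t)) powr a \<le> 2 powr (- a) * (1 + a * exp a * s)"
    by (intro mult_left_mono) auto
  moreover have "2 powr (- a) * (2 / (1 + t)) powr a = (1 + t) powr (- a)"
    using assms by (simp add: powr_divide powr_minus field_simps)
  ultimately show ?thesis by (simp add: s_def)
qed

lemma moebius_moment_Beta_bounds: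
  assumes a: "a > 0" and n: "n \<ge> 1"
  shows "2 powr (- a) * Beta (real n) (a + 1) \<le> moebius_moment a n"
    and "moebius_moment a n \<le> 2 powr (- a) * (Beta (real n) (a + 1) + a * exp a * Beta (real n) (a + 2))"
proof -
  have B: "((\<lambda>t. t ^ (n - 1) * (1 - t) powr b) has_integral Beta (real n) (b + 1)) {0..1}"
    if "b > 0" for b :: real
  proof -
    have "((\<lambda>t. t powr (real n - 1) * (1 - t) powr (b + 1 - 1)) has_integral Beta (real n) (b + 1)) {0..1}"
      using n that by (intro has_integral_Beta_real) auto
    thus ?thesis
    proof (rule has_integral_spike[where S = "{0}", rotated -1])
      fix t :: real assume "t \<in> {0..1} - {0}"
      thus "t ^ (n - 1) * (1 - t) powr b = t powr (real n - 1) * (1 - t) powr (b + 1 - 1)"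
        using n by (simp add: powr_realpow[symmetric] of_nat_diff)
    qed auto
  qed
  have M: "((\<lambda>t. t ^ (n - 1) * ((1 - t) powr a * (1 + t) powr (- a))) has_integral moebius_moment a n) {0..1}"
    unfolding moebius_moment_def using moebius_moment_integrable[OF a] by (rule integrable_integral)
  show "2 powr (- a) * Beta (real n) (a + 1) \<le> moebius_moment a n"
  proof (rule has_integral_le[OF has_integral_mult_right[OF B[OF a]] M])
    fix t :: real assume t: "t \<in> {0..1}"
    have "2 powr (- a) \<le> (1 + t) powr (- a)"
      using t a by (intro powr_mono2') auto
    thus "2 powr (- a) * (t ^ (n - 1) * (1 - t) powr a) \<le> t ^ (n - 1) * ((1 - t) powr a * (1 + t) powr (- a))"
      using t by (simp add: mult_left_mono mult_ac)
  qed
  have B2: "((\<lambda>t. t ^ (n - 1) * (1 - t) powr (a + 1)) has_integral Beta (real n) (a + 2)) {0..1}"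
    using B[of "a + 1"] a by (simp add: add_ac)
  show "moebius_moment a n \<le> 2 powr (- a) * (Beta (real n) (a + 1) + a * exp a * Beta (real n) (a + 2))"
  proof (rule has_integral_le[OF M has_integral_mult_right[OF has_integral_add[OF B[OF a]
            has_integral_mult_right[OF B2]]]])
    fix t :: real assume t: "t \<in> {0..1}"
    have *: "t ^ (n - 1) * (1 - t) powr a * (1 + t) powr (- a)
            \<le> t ^ (n - 1) * (1 - t) powr a * (2 powr (- a) * (1 + a * exp a * (1 - t)))"
      using t a by (intro mult_left_mono moebius_weight_upper_bound) auto
    have split: "(1 - t) powr (a + 1) = (1 - t) powr a * (1 - t)"
      using t by (cases "t = 1") (auto simp: powr_add)
    with * show "t ^ (n - 1) * ((1 - t) powr a * (1 + t) powr (- a))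
      \<le> 2 powr (- a) * (t ^ (n - 1) * (1 - t) powr a + a * exp a * (t ^ (n - 1) * (1 - t) powr (a + 1)))"
      unfolding split by (simp add: algebra_simps)
  qed
qed

lemma moebius_moment_asymptotics:
  assumes a: "a > 0"
  shows "(\<lambda>n. real n powr (1 + a) * moebius_moment a n) \<longlonglongrightarrow> 2 powr (- a) * Gamma (a + 1)"
proof (rule tendsto_sandwich)
  let ?B = "\<lambda>n. real n powr (a + 1) * Beta (real n) (a + 1)"
  let ?D = "\<lambda>n. (real n powr (a + 2) * Beta (real n) (a + 2)) / real n"
  have B: "?B \<longlonglongrightarrow> Gamma (a + 1)"
    using a by (intro Beta_nat_asymptotics) auto
  have D: "?D \<longlonglongrightarrow> 0"
    using tendsto_mult[OF Beta_nat_asymptotics[of "a + 2"] lim_inverse_n] a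
    by (simp add: divide_inverse)
  show "(\<lambda>n. 2 powr (- a) * ?B n) \<longlonglongrightarrow> 2 powr (- a) * Gamma (a + 1)"
    by (intro tendsto_intros B)
  have "(\<lambda>n. 2 powr (- a) * (?B n + a * exp a * ?D n)) \<longlonglongrightarrow>
           2 powr (- a) * (Gamma (a + 1) + a * exp a * 0)"
    by (intro tendsto_intros B D)
  thus "(\<lambda>n. 2 powr (- a) * (?B n + a * exp a * ?D n)) \<longlonglongrightarrow> 2 powr (- a) * Gamma (a + 1)"
    by simp
  show "eventually (\<lambda>n. 2 powr (- a) * ?B n \<le> real n powr (1 + a) * moebius_moment a n) sequentially"
    using eventually_ge_at_top[of 1]
  proof eventually_elim
    case (elim n)
    show ?case
      using mult_left_mono[OF moebius_moment_Beta_bounds(1)[OF a elim], of "real n powr (1 + a)"]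
      by (simp add: mult_ac add_ac)
  qed
  show "eventually (\<lambda>n. real n powr (1 + a) * moebius_moment a n
          \<le> 2 powr (- a) * (?B n + a * exp a * ?D n)) sequentially"
    using eventually_ge_at_top[of 1]
  proof eventually_elim
    case (elim n)
    have "real n powr (a + 2) = real n powr (1 + a) * real n"
      using elim powr_add[of "real n" "1 + a" 1] by (simp add: add_ac)
    thus ?case
      using mult_left_mono[OF moebius_moment_Beta_bounds(2)[OF a elim], of "real n powr (1 + a)"] elim
      by (simp add: algebra_simps)
  qed
qed

section \<open>The three-term recurrence\<close>

definition solves_recurrence :: "real \<Rightarrow> (nat \<Rightarrow> real) \<Rightarrow> bool" where
  "solves_recurrence \<epsilon> x \<longleftrightarrow>
     (\<forall>n\<ge>3. x n = (real n - 2) / real n * x (n - 2) + 2 / (\<epsilon> * real n) * x (n - 1))"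

lemma solves_recurrence_iff:
  "solves_recurrence \<epsilon> x \<longleftrightarrow>
     (\<forall>n\<ge>2. (real n + 1) * x (n + 1) = (real n - 1) * x (n - 1) + 2 / \<epsilon> * x n)"
proof -
  have shift: "(\<forall>n\<ge>3. P n) \<longleftrightarrow> (\<forall>n\<ge>2. P (Suc n))" for P
    by (metis Suc_le_D Suc_le_mono eval_nat_numeral(3))
  have "x n = (real n - 2) / real n * x (n - 2) + 2 / (\<epsilon> * real n) * x (n - 1) \<longleftrightarrow>
        real n * x n = (real n - 2) * x (n - 2) + 2 / \<epsilon> * x (n - 1)" if "n \<ge> 3" for n
    using that by (simp add: divide_simps) (simp add: algebra_simps)
  hence "solves_recurrence \<epsilon> x \<longleftrightarrow>
      (\<forall>n\<ge>3. real n * x n = (real n - 2) * x (n - 2) + 2 / \<epsilon> * x (n - 1))"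
    by (simp add: solves_recurrence_def)
  also have "\<dots> \<longleftrightarrow> (\<forall>n\<ge>2. real (Suc n) * x (Suc n) =
                 (real (Suc n) - 2) * x (Suc n - 2) + 2 / \<epsilon> * x (Suc n - 1))"
    by (rule shift)
  finally show ?thesis
    by (simp add: numeral_2_eq_2 add.commute)
qed

lemma solves_recurrence_step:
  assumes "solves_recurrence \<epsilon> x" "n \<ge> 1"
  shows "(real n + 2) * x (n + 2) = real n * x n + 2 / \<epsilon> * x (n + 1)"
proof -
  have "(real (n + 1) + 1) * x (n + 1 + 1) = (real (n + 1) - 1) * x (n + 1 - 1) + 2 / \<epsilon> * x (n + 1)"
    using assms unfolding solves_recurrence_iff by (metis Suc_1 Suc_eq_plus1 Suc_le_mono)
  moreover have "real (n + 1) + 1 = real n + 2" "n + 1 + 1 = n + 2" "real (n + 1) - 1 = real n"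
    by simp_all
  ultimately show ?thesis by (simp only: add_diff_cancel_right')
qed

text \<open>
  The discrete Wronskian. The weight \<open>n (n + 1)\<close> normalises it so that it only changes sign from
  one \<open>n\<close> to the next.
\<close>

definition casoratian :: "(nat \<Rightarrow> real) \<Rightarrow> (nat \<Rightarrow> real) \<Rightarrow> nat \<Rightarrow> real" where
  "casoratian x y n = real n * (real n + 1) * (x (n + 1) * y n - x n * y (n + 1))"

lemma casoratian_alternates:
  assumes x: "solves_recurrence \<epsilon> x" and y: "solves_recurrence \<epsilon> y" and n: "n \<ge> 1"
  shows "(-1) ^ n * casoratian x y n = - casoratian x y 1"
  using n
proof (induction n rule: dec_induct)
  case (step n)
  have X: "(real n + 2) * x (n + 2) = real n * x n + 2 / \<epsilon> * x (n + 1)"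
   and Y: "(real n + 2) * y (n + 2) = real n * y n + 2 / \<epsilon> * y (n + 1)"
    by (rule solves_recurrence_step[OF x step.hyps(1)], rule solves_recurrence_step[OF y step.hyps(1)])
  have "casoratian x y (Suc n) =
      (real n + 1) * (((real n + 2) * x (n + 2)) * y (n + 1) - x (n + 1) * ((real n + 2) * y (n + 2)))"
    by (simp add: casoratian_def algebra_simps)
  also have "\<dots> = - casoratian x y n"
    unfolding X Y by (simp add: casoratian_def algebra_simps)
  finally show ?case using step.IH by simp
qed simp

text \<open>
  The limit makes \<open>(-1)^n p n\<close> positive for large \<open>n\<close>. Read backwards, the recurrence for this
  sequence has positive coefficients, so positivity propagates down to \<open>n = 1\<close>.
\<close>

lemma alternating_solution_pos:
  assumes \<epsilon>: "\<epsilon> > 0" and p: "solves_recurrence \<epsilon> p"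
    and lim: "(\<lambda>n. real n powr c * ((-1) ^ n * p n)) \<longlonglongrightarrow> 1" and n: "n \<ge> 1"
  shows "(-1) ^ n * p n > 0"
proof -
  define y where "y = (\<lambda>n. (-1) ^ n * p n)"
  have rec: "real n * y n = (real n + 2) * y (n + 2) + 2 / \<epsilon> * y (n + 1)" if "n \<ge> 1" for n
  proof -
    have "(-1) ^ n * ((real n + 2) * p (n + 2)) = (-1) ^ n * (real n * p n + 2 / \<epsilon> * p (n + 1))"
      by (simp only: solves_recurrence_step[OF p that])
    thus ?thesis by (simp add: y_def algebra_simps)
  qed
  have "eventually (\<lambda>n. real n powr c * y n > 0) sequentially"
    using lim unfolding y_def by (rule order_tendstoD) simp
  then obtain N where N: "\<And>n. n \<ge> N \<Longrightarrow> real n powr c * y n > 0"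
    unfolding eventually_sequentially by auto
  have "y n > 0" if "n \<ge> 1" "n + k \<ge> N" for n k
    using that
  proof (induction k arbitrary: n rule: less_induct)
    case (less k)
    show ?case
    proof (cases "n \<ge> N")
      case True
      with N[of n] less.prems show ?thesis by (simp add: zero_less_mult_iff)
    next
      case False
      with less.prems obtain j where k: "k = Suc j" by (cases k) auto
      have "y (n + 1) > 0" "y (n + 2) > 0"
        using less.IH[of j "n + 1"] less.IH[of j "n + 2"] less.prems k by auto
      hence "real n * y n > 0"
        unfolding rec[OF less.prems(1)] using \<epsilon> by (intro add_pos_pos[OF mult_pos_pos mult_pos_pos]) auto
      thus ?thesis using less.prems by (simp add: zero_less_mult_iff)
    qed
  qed
  from this[of n N] n show ?thesis by (simp add: y_def)
qed

text \<open>
  With the sequences rescaled to have limit \<open>1\<close>, the Casorati determinant of two such solutions is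
  bounded by a quantity that tends to \<open>0\<close>; since its modulus is constant it vanishes, so the
  solutions are proportional, and the limits force the factor to be \<open>1\<close>.
\<close>

lemma alternating_solution_unique:
  assumes \<epsilon>: "\<epsilon> > 0" and c: "c \<ge> 1"
    and p: "solves_recurrence \<epsilon> p" "(\<lambda>n. real n powr c * ((-1) ^ n * p n)) \<longlonglongrightarrow> 1"
    and q: "solves_recurrence \<epsilon> q" "(\<lambda>n. real n powr c * ((-1) ^ n * q n)) \<longlonglongrightarrow> 1"
    and n: "n \<ge> 1"
  shows "p n = q n"
proof -
  define Y where "Y = (\<lambda>n. real n powr c * ((-1) ^ n * p n))"
  define Z where "Z = (\<lambda>n. real n powr c * ((-1) ^ n * q n))"
  have YZ: "Y \<longlonglongrightarrow> 1" "Z \<longlonglongrightarrow> 1" using p q by (simp_all add: Y_def Z_def)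
  (* The weight n (n + 1) is absorbed by n^c (n + 1)^c because c is at least 1. *)
  have le: "\<bar>casoratian p q 1\<bar> \<le> \<bar>Y (Suc n) * Z n - Y n * Z (Suc n)\<bar>" if n: "n \<ge> 1" for n
  proof -
    have "real n * (real n + 1) \<le> real n powr c * (real n + 1) powr c"
      using n c powr_mono[of 1 c "real n"] powr_mono[of 1 c "real n + 1"]
      by (intro mult_mono) auto
    hence "real n * (real n + 1) * \<bar>p (n + 1) * q n - p n * q (n + 1)\<bar>
        \<le> real n powr c * (real n + 1) powr c * \<bar>p (n + 1) * q n - p n * q (n + 1)\<bar>"
      by (intro mult_right_mono) auto
    moreover have "Y (Suc n) * Z n - Y n * Z (Suc n) =
        - (real n powr c * (real n + 1) powr c * (p (n + 1) * q n - p n * q (n + 1)))"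
      by (simp add: Y_def Z_def algebra_simps flip: power_add mult_2)
    moreover have "\<bar>casoratian p q 1\<bar> = \<bar>casoratian p q n\<bar>"
      using arg_cong[OF casoratian_alternates[OF p(1) q(1) n], of abs] by (simp add: abs_mult power_abs)
    ultimately show ?thesis by (simp add: casoratian_def abs_mult)
  qed
  have "(\<lambda>n. \<bar>Y (Suc n) * Z n - Y n * Z (Suc n)\<bar>) \<longlonglongrightarrow> \<bar>1 * 1 - 1 * 1\<bar>"
    by (intro tendsto_intros YZ LIMSEQ_Suc)
  hence "\<bar>casoratian p q 1\<bar> \<le> \<bar>1 * 1 - 1 * 1\<bar>"
    by (rule tendsto_lowerbound) (rule eventually_sequentiallyI[of 1, OF le], simp_all)
  hence "casoratian p q n = 0" if "n \<ge> 1" for n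
    using casoratian_alternates[OF p(1) q(1) that] by simp
  hence cross: "p (n + 1) * q n = p n * q (n + 1)" if "n \<ge> 1" for n
    using that by (simp add: casoratian_def)
  have q0: "q n \<noteq> 0" if "n \<ge> 1" for n
    using alternating_solution_pos[OF \<epsilon> q that] by (metis less_irrefl mult_zero_right)
  have ratio: "p n / q n = p 1 / q 1" if "n \<ge> 1" for n
    using that
  proof (induction n rule: dec_induct)
    case (step n)
    have "p (Suc n) / q (Suc n) = p n / q n"
      using cross[OF step.hyps(1)] q0[OF step.hyps(1)] q0[of "Suc n"] by (simp add: frac_eq_eq)
    thus ?case using step.IH by simp
  qed simp
  have "(\<lambda>n. Y n / Z n) \<longlonglongrightarrow> 1 / 1" by (intro tendsto_intros YZ) auto
  moreover have "eventually (\<lambda>n. Y n / Z n = p 1 / q 1) sequentially"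
    using eventually_ge_at_top[of 1]
  proof eventually_elim
    case (elim n)
    thus ?case using ratio[OF elim] by (simp add: Y_def Z_def)
  qed
  ultimately have "p 1 / q 1 = 1"
    using LIMSEQ_unique[OF _ tendsto_eventually] by fastforce
  thus ?thesis using ratio[OF n] q0[OF n] by simp
qed

text \<open>
  The normalised moments, with alternating signs, are a solution; the factor \<open>(-1)^n\<close> accounts for
  the opposite sign of the middle term in \<open>moebius_moment_recurrence\<close>.
\<close>

lemma ex1_alternating_solution:
  assumes \<epsilon>: "\<epsilon> > 0"
  shows "\<exists>!p. p 0 = 0 \<and> solves_recurrence \<epsilon> p \<and>
              (\<lambda>n. real n powr (1 + 1 / \<epsilon>) * ((-1) ^ n * p n)) \<longlonglongrightarrow> 1"
proof (rule ex_ex1I)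
  define a where "a = 1 / \<epsilon>"
  have a: "a > 0" using \<epsilon> by (simp add: a_def)
  define L where "L = 2 powr (- a) * Gamma (a + 1)"
  have "Gamma (a + 1) > 0" using a by (intro Gamma_real_pos) auto
  hence L: "L > 0" by (simp add: L_def)
  define p where "p = (\<lambda>n. if n = 0 then 0 else (-1) ^ n * moebius_moment a n / L)"
  have "solves_recurrence \<epsilon> p"
    unfolding solves_recurrence_iff
  proof (intro allI impI)
    fix n :: nat assume n: "n \<ge> 2"
    then obtain k where k: "n = k + 2" by (metis add.commute le_Suc_ex)
    have "(real n + 1) * p (n + 1) =
      (-1) ^ (n + 1) * ((real n + 1) * moebius_moment a (n + 1)) / L"
      by (simp add: p_def)
    also have "\<dots> = (-1) ^ (n + 1) * ((real n - 1) * moebius_moment a (n - 1) - 2 * a * moebius_moment a n) / L"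
      by (subst moebius_moment_recurrence[OF a n]) simp
    also have "\<dots> = (real n - 1) * p (n - 1) + 2 / \<epsilon> * p n"
      by (simp add: p_def k a_def algebra_simps add_divide_distrib diff_divide_distrib)
    finally show "(real n + 1) * p (n + 1) = (real n - 1) * p (n - 1) + 2 / \<epsilon> * p n" .
  qed
  moreover have "(\<lambda>n. real n powr (1 + 1 / \<epsilon>) * ((-1) ^ n * p n)) \<longlonglongrightarrow> 1"
  proof -
    have "(\<lambda>n. (real n powr (1 + a) * moebius_moment a n) / L) \<longlonglongrightarrow> L / L"
      using L moebius_moment_asymptotics[OF a, folded L_def]
      by (intro tendsto_divide tendsto_const) simp_all
    hence "(\<lambda>n. (real n powr (1 + a) * moebius_moment a n) / L) \<longlonglongrightarrow> 1" using L by simp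
    thus ?thesis
      by (rule Lim_transform_eventually)
         (auto intro!: eventually_sequentiallyI[of 1] simp: p_def a_def simp flip: power_add mult_2)
  qed
  ultimately show "\<exists>p. p 0 = 0 \<and> solves_recurrence \<epsilon> p \<and>
              (\<lambda>n. real n powr (1 + 1 / \<epsilon>) * ((-1) ^ n * p n)) \<longlonglongrightarrow> 1"
    by (intro exI[of _ p]) (simp add: p_def)
next
  fix p q
  assume p: "p 0 = 0 \<and> solves_recurrence \<epsilon> p \<and> (\<lambda>n. real n powr (1 + 1 / \<epsilon>) * ((-1) ^ n * p n)) \<longlonglongrightarrow> 1"
  assume q: "q 0 = 0 \<and> solves_recurrence \<epsilon> q \<and> (\<lambda>n. real n powr (1 + 1 / \<epsilon>) * ((-1) ^ n * q n)) \<longlonglongrightarrow> 1"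
  have "p n = q n" if "n \<ge> 1" for n
    using alternating_solution_unique[OF \<epsilon> _ _ _ _ _ that, of "1 + 1 / \<epsilon>" p q] p q \<epsilon> by simp
  thus "p = q" using p q by (metis ext less_one not_le)
qed

section \<open>The sequences \<open>\<phi>\<close>, \<open>\<psi>\<close> and \<open>\<sigma>\<close>\<close>

lemma
  assumes "\<epsilon> > 0"
  shows psi_0: "psi \<epsilon> 0 = 0"
    and solves_psi: "solves_recurrence \<epsilon> (psi \<epsilon>)"
    and w_asymptotics: "(\<lambda>n. real n powr (1 + 1 / \<epsilon>) * w \<epsilon> n) \<longlonglongrightarrow> 1"
proof -
  let ?P = "\<lambda>p. p 0 = 0 \<and> solves_recurrence \<epsilon> p \<and>
                 (\<lambda>n. real n powr (1 + 1 / \<epsilon>) * ((-1) ^ n * p n)) \<longlonglongrightarrow> 1"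
  have "psi \<epsilon> = (THE p. ?P p)" by (simp only: psi_def solves_recurrence_def)
  with theI'[OF ex1_alternating_solution[OF assms]] have "?P (psi \<epsilon>)" by (simp only:)
  thus "psi \<epsilon> 0 = 0" "solves_recurrence \<epsilon> (psi \<epsilon>)"
       "(\<lambda>n. real n powr (1 + 1 / \<epsilon>) * w \<epsilon> n) \<longlonglongrightarrow> 1"
    by (simp_all only: w_def)
qed

lemma psi_eq_w: "psi \<epsilon> n = (-1) ^ n * w \<epsilon> n"
  by (simp add: w_def flip: power_add mult_2)

lemma w_pos: "\<epsilon> > 0 \<Longrightarrow> n \<ge> 1 \<Longrightarrow> w \<epsilon> n > 0"
  using alternating_solution_pos[OF _ solves_psi, of \<epsilon> "1 + 1 / \<epsilon>" n] w_asymptotics[of \<epsilon>]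
  by (simp add: w_def)

lemma phi_0: "phi \<epsilon> 0 = 0" and phi_1: "phi \<epsilon> 1 = 1" and phi_2: "phi \<epsilon> 2 = 1 / \<epsilon>"
  by (subst phi.simps; simp)+

lemma solves_phi: "solves_recurrence \<epsilon> (phi \<epsilon>)"
  unfolding solves_recurrence_def
proof (intro allI impI)
  fix n :: nat assume "n \<ge> 3"
  thus "phi \<epsilon> n = (real n - 2) / real n * phi \<epsilon> (n - 2) + 2 / (\<epsilon> * real n) * phi \<epsilon> (n - 1)"
    by (subst phi.simps) simp
qed

text \<open>The second initial value of \<open>\<phi>\<close> makes the recurrence valid also at \<open>n = 1\<close>.\<close>

lemma phi_recurrence:
  assumes "n \<ge> 1"
  shows "(real n + 1) * phi \<epsilon> (n + 1) = (real n - 1) * phi \<epsilon> (n - 1) + 2 / \<epsilon> * phi \<epsilon> n"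
proof (cases "n = 1")
  case True
  thus ?thesis using phi_1[of \<epsilon>] phi_2[of \<epsilon>] by (simp add: numeral_2_eq_2)
next
  case False
  with assms solves_phi show ?thesis unfolding solves_recurrence_iff by simp
qed

lemma phi_pos:
  assumes "\<epsilon> > 0" "n \<ge> 1"
  shows "phi \<epsilon> n > 0"
  using assms(2)
proof (induction n rule: less_induct)
  case (less n)
  show ?case
  proof (cases "n = 1")
    case True thus ?thesis using phi_1[of \<epsilon>] by simp
  next
    case False
    with less.prems obtain m where m: "n = m + 1" "m \<ge> 1" by (cases n) auto
    have "phi \<epsilon> (m - 1) \<ge> 0"
      using less.IH[of "m - 1"] m by (cases "m = 1") (auto simp: phi_0 intro: less_imp_le)
    hence "(real m + 1) * phi \<epsilon> (m + 1) > 0"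
      unfolding phi_recurrence[OF m(2)] using less.IH[of m] m assms
      by (intro add_nonneg_pos mult_nonneg_nonneg mult_pos_pos) auto
    thus ?thesis using m by (simp add: zero_less_mult_iff)
  qed
qed

lemma sigma_eq:
  assumes "\<epsilon> > 0" "n \<ge> 1"
  shows "sigma \<epsilon> n = \<epsilon> / 2 * real n * (real n + 1) * (phi \<epsilon> (n + 1) * w \<epsilon> n + phi \<epsilon> n * w \<epsilon> (n + 1))"
proof -
  have "sigma \<epsilon> n = \<epsilon> / 2 * real n * (((real n - 1) * phi \<epsilon> (n - 1) + 2 / \<epsilon> * phi \<epsilon> n) * w \<epsilon> n
                      + (real n + 1) * phi \<epsilon> n * w \<epsilon> (n + 1))"
    using assms by (simp add: sigma_def field_simps)
  thus ?thesis
    unfolding phi_recurrence[OF assms(2), symmetric] by (simp add: algebra_simps add_divide_distrib)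
qed

text \<open>Up to a sign and a factor, \<open>\<sigma>\<close> is the Casorati determinant of \<open>\<phi>\<close> and \<open>\<psi>\<close>.\<close>

lemma sigma_constant:
  assumes "\<epsilon> > 0" "n \<ge> 1"
  shows "sigma \<epsilon> n = sigma \<epsilon> 1"
proof -
  have "sigma \<epsilon> n = \<epsilon> / 2 * ((-1) ^ n * casoratian (phi \<epsilon>) (psi \<epsilon>) n)" if "n \<ge> 1" for n
    using sigma_eq[OF assms(1) that]
    by (simp add: casoratian_def psi_eq_w algebra_simps add_divide_distrib flip: power_add mult_2)
  thus ?thesis
    using casoratian_alternates[OF solves_phi solves_psi] assms by simp
qed

lemma sigma_pos: "\<epsilon> > 0 \<Longrightarrow> n \<ge> 1 \<Longrightarrow> sigma \<epsilon> n > 0"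
  by (simp add: sigma_eq phi_pos w_pos add_pos_pos)

section \<open>Growth and decay estimates\<close>

lemma w_bounds:
  assumes \<epsilon>: "\<epsilon> > 0"
  obtains c C where "c > 0" "C > 0"
    "\<And>n. n \<ge> 1 \<Longrightarrow> c * real n powr - (1 + 1 / \<epsilon>) \<le> w \<epsilon> n"
    "\<And>n. n \<ge> 1 \<Longrightarrow> w \<epsilon> n \<le> C * real n powr - (1 + 1 / \<epsilon>)"
proof -
  let ?z = "\<lambda>n. real n powr (1 + 1 / \<epsilon>) * w \<epsilon> n"
  have lim: "?z \<longlonglongrightarrow> 1" by (rule w_asymptotics[OF \<epsilon>])
  obtain C where C: "C > 0" "\<And>n. norm (?z n) \<le> C"
    using convergent_imp_Bseq[OF convergentI[OF lim]] by (auto elim: BseqE)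
  have lim': "(\<lambda>n. inverse (?z n)) \<longlonglongrightarrow> inverse 1" by (intro tendsto_intros lim) auto
  obtain D where D: "D > 0" "\<And>n. norm (inverse (?z n)) \<le> D"
    using convergent_imp_Bseq[OF convergentI[OF lim']] by (auto elim: BseqE)
  show ?thesis
  proof (rule that[of "inverse D" C])
    fix n :: nat assume n: "n \<ge> 1"
    have z: "?z n > 0" using w_pos[OF \<epsilon> n] n by simp
    have w: "w \<epsilon> n = ?z n * real n powr - (1 + 1 / \<epsilon>)"
    proof -
      have "real n powr (1 + 1 / \<epsilon>) * real n powr - (1 + 1 / \<epsilon>) = 1"
        using n by (subst powr_add[symmetric]) simp
      thus ?thesis by (metis mult.commute mult.left_commute mult_1_right)
    qed
    have "inverse (?z n) \<le> D" using D(2)[of n] z by simp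
    hence "inverse D \<le> ?z n"
      using z D(1) by (simp add: field_simps)
    thus "inverse D * real n powr - (1 + 1 / \<epsilon>) \<le> w \<epsilon> n"
      by (subst w) (intro mult_right_mono, auto)
    have "?z n \<le> C" using C(2)[of n] by simp
    thus "w \<epsilon> n \<le> C * real n powr - (1 + 1 / \<epsilon>)"
      by (subst w) (intro mult_right_mono, auto)
  qed (use C D in auto)
qed

text \<open>
  The growth of \<open>\<phi>\<close> is controlled without solving for it: both summands of \<open>\<sigma>\<close> are positive, so
  \<open>n (n + 1) \<phi> n w (n + 1)\<close> is bounded by a constant, and \<open>w\<close> is bounded below.
\<close>

lemma phi_upper_bound:
  assumes \<epsilon>: "\<epsilon> > 0"
  obtains C where "C > 0" "\<And>n. n \<ge> 1 \<Longrightarrow> phi \<epsilon> n \<le> C * real n powr (1 / \<epsilon> - 1)"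
proof -
  obtain c C where c: "c > 0" "\<And>n. n \<ge> 1 \<Longrightarrow> c * real n powr - (1 + 1 / \<epsilon>) \<le> w \<epsilon> n"
    using w_bounds[OF \<epsilon>] by metis
  define K where "K = \<epsilon> / 2 * c * 2 powr (- 1 / \<epsilon>)"
  have K: "K > 0" using \<epsilon> c by (simp add: K_def)
  show ?thesis
  proof (rule that[of "sigma \<epsilon> 1 / K"])
    show "sigma \<epsilon> 1 / K > 0" using K sigma_pos[OF \<epsilon>, of 1] by simp
    fix n :: nat assume n: "n \<ge> 1"
    have "K * (real n * real n powr (- 1 / \<epsilon>)) = \<epsilon> / 2 * c * (real n * (2 * real n) powr (- 1 / \<epsilon>))"
      using n by (simp add: K_def powr_mult)
    also have "\<dots> \<le> \<epsilon> / 2 * c * (real n * (real n + 1) powr (- 1 / \<epsilon>))"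
      using n \<epsilon> c by (intro mult_left_mono powr_mono2') auto
    also have "(real n + 1) powr (- 1 / \<epsilon>) = (real n + 1) * real (n + 1) powr - (1 + 1 / \<epsilon>)"
      using powr_add[of "real n + 1" 1 "- (1 + 1 / \<epsilon>)"] by (simp add: add_ac)
    also have "\<epsilon> / 2 * c * (real n * ((real n + 1) * real (n + 1) powr - (1 + 1 / \<epsilon>)))
         = \<epsilon> / 2 * real n * (real n + 1) * (c * real (n + 1) powr - (1 + 1 / \<epsilon>))"
      by (simp add: mult_ac)
    also have "\<dots> \<le> \<epsilon> / 2 * real n * (real n + 1) * w \<epsilon> (n + 1)"
      using \<epsilon> by (intro mult_left_mono c) auto
    finally have "K * (real n * real n powr (- 1 / \<epsilon>)) * phi \<epsilon> n
        \<le> \<epsilon> / 2 * real n * (real n + 1) * w \<epsilon> (n + 1) * phi \<epsilon> n"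
      using phi_pos[OF \<epsilon> n] by (intro mult_right_mono) auto
    also have "\<dots> \<le> sigma \<epsilon> n"
      using phi_pos[OF \<epsilon>, of "n + 1"] w_pos[OF \<epsilon> n] \<epsilon> n
      by (simp add: sigma_eq[OF \<epsilon> n] algebra_simps)
    finally have "K * (real n * real n powr (- 1 / \<epsilon>)) * phi \<epsilon> n \<le> sigma \<epsilon> 1"
      using sigma_constant[OF \<epsilon> n] by simp
    moreover have "real n powr (1 / \<epsilon> - 1) * (real n * real n powr (- 1 / \<epsilon>)) = 1"
      using n by (simp add: powr_diff powr_minus_divide)
    ultimately show "phi \<epsilon> n \<le> sigma \<epsilon> 1 / K * real n powr (1 / \<epsilon> - 1)"
      using K n by (simp add: powr_diff powr_minus_divide field_simps)
  qed
qed

text \<open>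
  On or above the diagonal \<open>\<phi> m * w n\<close> is at most a constant times
  \<open>(m / n) powr (1 / \<epsilon>) / (m n)\<close>, and the first factor is at most \<open>1\<close>.
\<close>

lemma abs_rho_le:
  assumes \<epsilon>: "\<epsilon> > 0"
  obtains C where "C > 0" "\<And>m n. m \<ge> 1 \<Longrightarrow> n \<ge> 1 \<Longrightarrow> \<bar>rho \<epsilon> m n\<bar> \<le> C / (real m * real n)"
proof -
  obtain C where C: "C > 0" "\<And>n. n \<ge> 1 \<Longrightarrow> phi \<epsilon> n \<le> C * real n powr (1 / \<epsilon> - 1)"
    using phi_upper_bound[OF \<epsilon>] by metis
  obtain c D where D: "D > 0" "\<And>n. n \<ge> 1 \<Longrightarrow> w \<epsilon> n \<le> D * real n powr - (1 + 1 / \<epsilon>)"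
    using w_bounds[OF \<epsilon>] by metis
  have prod_le: "phi \<epsilon> m * w \<epsilon> n \<le> C * D / (real m * real n)" if "1 \<le> m" "m \<le> n" for m n
  proof -
    have "phi \<epsilon> m * w \<epsilon> n \<le> (C * real m powr (1 / \<epsilon> - 1)) * (D * real n powr - (1 + 1 / \<epsilon>))"
      using that phi_pos[OF \<epsilon>, of m] w_pos[OF \<epsilon>, of n] C(1) by (intro mult_mono C D) auto
    also have "\<dots> = C * D * (real m powr (1 / \<epsilon>) / real n powr (1 / \<epsilon>)) / (real m * real n)"
      using that by (simp add: powr_diff powr_minus_divide powr_add mult_ac)
    also have "\<dots> \<le> C * D * 1 / (real m * real n)"
      using that \<epsilon> C(1) D(1)
      by (intro divide_right_mono mult_left_mono) (auto simp: divide_le_eq intro!: powr_mono2)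
    finally show ?thesis by simp
  qed
  let ?s = "sigma \<epsilon> 1"
  have s: "?s > 0" using sigma_pos[OF \<epsilon>] by simp
  show ?thesis
  proof (rule that[of "C * D / ?s"])
    show "C * D / ?s > 0" using C D s by simp
    fix m n :: nat assume mn: "m \<ge> 1" "n \<ge> 1"
    have "\<bar>rho \<epsilon> m n\<bar> = phi \<epsilon> (min m n) * w \<epsilon> (max m n) / ?s"
      using mn s phi_pos[OF \<epsilon>, of m] phi_pos[OF \<epsilon>, of n] w_pos[OF \<epsilon>, of m] w_pos[OF \<epsilon>, of n]
      by (auto simp: rho_def psi_eq_w sigma_constant[OF \<epsilon>, of n] abs_mult power_abs min_def max_def)
    also have "\<dots> \<le> (C * D / (real (min m n) * real (max m n))) / ?s"
      using mn s by (intro divide_right_mono prod_le) auto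
    also have "real (min m n) * real (max m n) = real m * real n"
      by (simp add: min_def max_def)
    finally show "\<bar>rho \<epsilon> m n\<bar> \<le> C * D / ?s / (real m * real n)" by (simp add: mult_ac)
  qed
qed

text \<open>
  As \<open>\<sigma>\<close> is a positive constant and \<open>w\<close> is bounded above by a multiple of \<open>n powr -(1 + 1 / \<epsilon>)\<close>, two
  consecutive values satisfy \<open>\<phi> n + \<phi> (n + 1) \<ge> c n powr (1 / \<epsilon> - 1)\<close>. For \<open>\<epsilon> < 2\<close> the square of
  the right-hand side dominates the harmonic series.
\<close>

lemma phi_not_square_summable:
  assumes \<epsilon>: "\<epsilon> > 0" "\<epsilon> < 2"
  shows "\<not> (\<lambda>n. (phi \<epsilon> n)\<^sup>2) summable_on {1..}"
proof
  assume "(\<lambda>n. (phi \<epsilon> n)\<^sup>2) summable_on {1..}"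
  hence "(\<lambda>n. (phi \<epsilon> n)\<^sup>2) summable_on UNIV"
    by (rule summable_on_cong_neutral[THEN iffD1, rotated -1]) (auto simp: not_le phi_0)
  hence S: "summable (\<lambda>n. (phi \<epsilon> n)\<^sup>2)"
    by (rule summable_on_imp_summable)
  obtain C where C: "C > 0" "\<And>n. n \<ge> 1 \<Longrightarrow> w \<epsilon> n \<le> C * real n powr - (1 + 1 / \<epsilon>)"
    using w_bounds[OF \<epsilon>(1)] by metis
  let ?s = "sigma \<epsilon> 1"
  have s: "?s > 0" using sigma_pos[OF \<epsilon>(1)] by simp
  define K where "K = \<epsilon> * C / ?s"
  have K: "K > 0" using \<epsilon> C s by (simp add: K_def)
  have le: "norm (inverse (real n)) \<le> 2 * K\<^sup>2 * ((phi \<epsilon> (Suc n))\<^sup>2 + (phi \<epsilon> n)\<^sup>2)" if n: "n \<ge> 1" for n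
  proof -
    let ?x = "phi \<epsilon> (n + 1)" and ?y = "phi \<epsilon> n"
    have xy: "?x > 0" "?y > 0" using phi_pos[OF \<epsilon>(1)] n by auto
    have "w \<epsilon> (n + 1) \<le> C * real (n + 1) powr - (1 + 1 / \<epsilon>)" by (intro C) auto
    also have "\<dots> \<le> C * real n powr - (1 + 1 / \<epsilon>)"
    proof -
      have "1 / \<epsilon> > 0" using \<epsilon> by simp
      hence "- (1 + 1 / \<epsilon>) \<le> 0" by linarith
      thus ?thesis using n C by (intro mult_left_mono powr_mono2') auto
    qed
    finally have w': "w \<epsilon> (n + 1) \<le> C * real n powr - (1 + 1 / \<epsilon>)" .
    have "?s = \<epsilon> / 2 * real n * (real n + 1) * (?x * w \<epsilon> n + ?y * w \<epsilon> (n + 1))"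
      using sigma_eq[OF \<epsilon>(1) n] sigma_constant[OF \<epsilon>(1) n] by simp
    also have "\<dots> \<le> \<epsilon> / 2 * real n * (2 * real n) *
        (?x * (C * real n powr - (1 + 1 / \<epsilon>)) + ?y * (C * real n powr - (1 + 1 / \<epsilon>)))"
      using n \<epsilon> xy w' C(2)[OF n] w_pos[OF \<epsilon>(1), of n] w_pos[OF \<epsilon>(1), of "n + 1"]
      by (intro mult_mono add_mono mult_left_mono add_nonneg_nonneg mult_nonneg_nonneg) auto
    also have "\<dots> = \<epsilon> * C * ((?x + ?y) * (real n * real n * real n powr - (1 + 1 / \<epsilon>)))"
      by (simp add: algebra_simps)
    also have "real n * real n * real n powr - (1 + 1 / \<epsilon>) = real n powr (1 - 1 / \<epsilon>)"
      using n by (simp add: powr_diff powr_minus_divide powr_add)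
    finally have "1 \<le> K * (?x + ?y) * real n powr (1 - 1 / \<epsilon>)"
      using s by (simp add: K_def field_simps)
    hence "1\<^sup>2 \<le> (K * (?x + ?y) * real n powr (1 - 1 / \<epsilon>))\<^sup>2"
      by (intro power_mono) auto
    also have "\<dots> = (K * (?x + ?y))\<^sup>2 * real n powr (2 - 2 / \<epsilon>)"
      using n by (simp add: power_mult_distrib powr_power)
    also have "\<dots> \<le> (K * (?x + ?y))\<^sup>2 * real n powr 1"
      using n \<epsilon> by (intro mult_left_mono powr_mono) (auto simp: field_simps)
    finally have "1 \<le> K\<^sup>2 * (?x + ?y)\<^sup>2 * real n"
      by (simp add: power_mult_distrib)
    hence "inverse (real n) \<le> K\<^sup>2 * (?x + ?y)\<^sup>2"
      using n by (simp add: inverse_eq_divide divide_le_eq)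
    also have "\<dots> \<le> K\<^sup>2 * (2 * (?x\<^sup>2 + ?y\<^sup>2))"
      using sum_squares_bound[of ?x ?y] by (intro mult_left_mono) (auto simp: power2_sum)
    finally show ?thesis by (simp add: algebra_simps)
  qed
  have "summable (\<lambda>n. 2 * K\<^sup>2 * ((phi \<epsilon> (Suc n))\<^sup>2 + (phi \<epsilon> n)\<^sup>2))"
    using S summable_Suc_iff[of "\<lambda>n. (phi \<epsilon> n)\<^sup>2"] by (intro summable_mult summable_add) simp_all
  hence "summable (\<lambda>n. inverse (real n))"
    by (rule summable_comparison_test[rotated]) (use le in auto)
  thus False using not_summable_harmonic[where 'a = real] by simp
qed

section \<open>The operator and its inverse\<close>

lemma A_plus_eq:
  assumes "\<epsilon> \<noteq> 0"
  shows "A_plus \<epsilon> v n = of_real (\<epsilon> / 2) * of_nat n *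
    (of_real (real n - 1) * v (n - 1) - of_real (real n + 1) * v (n + 1) + of_real (2 / \<epsilon>) * v n)"
  using assms by (simp add: A_plus_def field_simps)

lemma A_plus_lincomb:
  "A_plus \<epsilon> (\<lambda>i. f i + c * g i) = (\<lambda>n. A_plus \<epsilon> f n + c * A_plus \<epsilon> g n)"
  by (simp add: A_plus_def fun_eq_iff algebra_simps add_divide_distrib diff_divide_distrib)

text \<open>
  The first equation, at \<open>n = 1\<close>, ties the second entry to the first, so the kernel on sequences
  that vanish at \<open>0\<close> is one-dimensional although the recurrence is of order two.
\<close>

lemma A_plus_kernel:
  assumes \<epsilon>: "\<epsilon> > 0" and v0: "v 0 = 0" and A: "\<And>n. A_plus \<epsilon> v n = 0"
  shows "v n = v 1 * of_real (phi \<epsilon> n)"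
proof (induction n rule: less_induct)
  case (less n)
  consider "n = 0" | "n = 1" | m where "n = m + 1" "m \<ge> 1"
    by (cases n; cases "n = 1") auto
  thus ?case
  proof cases
    case 1 thus ?thesis by (simp add: v0 phi_0)
  next
    case 2 thus ?thesis using phi_1[of \<epsilon>] by simp
  next
    case (3 m)
    have "of_real (real m + 1) * v (m + 1) =
        of_real (real m - 1) * v (m - 1) + of_real (2 / \<epsilon>) * v m"
    proof -
      have "of_real (\<epsilon> / 2) * of_nat m * (of_real (real m - 1) * v (m - 1) -
              of_real (real m + 1) * v (m + 1) + of_real (2 / \<epsilon>) * v m) = 0"
        using A[of m] \<epsilon> by (subst A_plus_eq[symmetric]) auto
      moreover have "complex_of_real (\<epsilon> / 2) * of_nat m \<noteq> 0" using \<epsilon> 3 by simp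
      ultimately have "of_real (real m - 1) * v (m - 1) -
              of_real (real m + 1) * v (m + 1) + of_real (2 / \<epsilon>) * v m = 0"
        by (metis mult_eq_0_iff)
      moreover have "x - y + z = 0 \<Longrightarrow> y = x + z" for x y z :: complex
        by (auto simp: algebra_simps)
      ultimately show ?thesis by blast
    qed
    also have "\<dots> = v 1 * of_real ((real m - 1) * phi \<epsilon> (m - 1) + 2 / \<epsilon> * phi \<epsilon> m)"
      using less.IH[of m] less.IH[of "m - 1"] 3 by (simp add: algebra_simps)
    also have "\<dots> = of_real (real m + 1) * (v 1 * of_real (phi \<epsilon> (m + 1)))"
      unfolding phi_recurrence[OF 3(2), symmetric] by (simp add: algebra_simps)
    finally have "of_real (real m + 1) * v (m + 1) = of_real (real m + 1) * (v 1 * of_real (phi \<epsilon> (m + 1)))" .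
    moreover have "of_real (real m + 1) \<noteq> (0 :: complex)"
      by (metis add_pos_nonneg of_nat_0_le_iff of_real_eq_0_iff add.commute less_irrefl zero_less_one)
    ultimately show ?thesis using 3 by (metis mult_left_cancel)
  qed
qed

text \<open>
  The kernel is separable on either side of the diagonal. The identity
  extends to \<open>m = 0\<close>, where \<open>\<phi>\<close> and \<open>\<psi>\<close> vanish.
\<close>

lemma R_op_split:
  fixes f :: "nat \<Rightarrow> complex"
  assumes \<epsilon>: "\<epsilon> > 0"
  defines "S \<equiv> \<lambda>m. \<Sum>n=1..<m. (-1) ^ n * of_real (phi \<epsilon> n) * f n"
      and "T \<equiv> \<lambda>m. \<Sum>\<^sub>\<infinity>n\<in>{m..}. of_real (w \<epsilon> n) * f n"
  assumes sum: "(\<lambda>n. of_real (w \<epsilon> n) * f n) summable_on {1..}"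
  shows "of_real (sigma \<epsilon> 1) * R_op \<epsilon> f m = of_real (psi \<epsilon> m) * S m + of_real (phi \<epsilon> m) * T m"
proof (cases "m = 0")
  case True
  thus ?thesis by (simp add: R_op_def kernel_op_def phi_0 psi_0[OF \<epsilon>])
next
  case False
  let ?s = "sigma \<epsilon> 1" and ?r = "\<lambda>n. of_real (rho \<epsilon> m n) * f n"
  have s: "?s > 0" using sigma_pos[OF \<epsilon>] by simp
  have r1: "?r n = of_real (psi \<epsilon> m / ?s) * ((-1) ^ n * of_real (phi \<epsilon> n) * f n)"
    if "n \<in> {1..<m}" for n
    using that by (simp add: rho_def sigma_constant[OF \<epsilon>, of n])
  have r2: "?r n = of_real (phi \<epsilon> m / ?s) * (of_real (w \<epsilon> n) * f n)" if "n \<in> {m..}" for n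
    using that False by (simp add: rho_def sigma_constant[OF \<epsilon>, of n] w_def)
  have sum': "(\<lambda>n. of_real (w \<epsilon> n) * f n) summable_on {m..}"
    by (rule summable_on_subset_banach[OF sum]) (use False in auto)
  have r2_sum: "?r summable_on {m..}"
    by (rule summable_on_cong[THEN iffD2, OF r2 summable_on_cmult_right[OF sum']])
  have "R_op \<epsilon> f m = infsum ?r ({1..<m} \<union> {m..})"
    using False by (auto simp: R_op_def kernel_op_def intro!: infsum_cong_neutral)
  also have "\<dots> = infsum ?r {1..<m} + infsum ?r {m..}"
    by (intro infsum_Un_disjoint r2_sum) auto
  also have "infsum ?r {1..<m} = of_real (psi \<epsilon> m / ?s) * S m"
    by (simp only: infsum_finite finite_atLeastLessThan S_def sum_distrib_left) (rule sum.cong[OF refl r1])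
  also have "infsum ?r {m..} = of_real (phi \<epsilon> m / ?s) * T m"
    by (subst infsum_cong[OF r2], assumption, simp only: infsum_cmult_right' T_def)
  finally show ?thesis using s by (simp add: field_simps)
qed

text \<open>
  Write \<open>v = R f\<close>, so that \<open>\<sigma> v m = \<psi> m * S m + \<phi> m * T m\<close>. In the formula for \<open>A\<^sub>+ v\<close> at \<open>n\<close>,
  express the three values \<open>S (n-1)\<close>, \<open>S n\<close>, \<open>S (n+1)\<close> through \<open>S n\<close>, and likewise for \<open>T\<close>.
  At \<open>n - 1\<close> the two correction terms cancel, because \<open>\<psi> = (-1)^n w\<close>; at \<open>n + 1\<close> they add up to
  a Casorati determinant. The coefficients of \<open>S n\<close> and \<open>T n\<close> vanish by the recurrence, with
  one exception: \<open>\<psi>\<close> violates it at \<open>n = 1\<close>, but there \<open>S 1\<close> is the empty sum. What remains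
  is \<open>\<sigma> f n\<close>.
\<close>

lemma A_plus_R_op:
  assumes \<epsilon>: "\<epsilon> > 0" and f0: "f 0 = 0"
    and sum: "(\<lambda>n. of_real (w \<epsilon> n) * f n) summable_on {1..}"
  shows "A_plus \<epsilon> (R_op \<epsilon> f) n = f n"
proof (cases "n = 0")
  case True
  thus ?thesis using f0 by (simp add: A_plus_def)
next
  case False
  hence n: "n \<ge> 1" by simp
  define v where "v = R_op \<epsilon> f"
  define S where "S = (\<lambda>m. \<Sum>n=1..<m. (-1) ^ n * of_real (phi \<epsilon> n) * f n)"
  define T where "T = (\<lambda>m. \<Sum>\<^sub>\<infinity>n\<in>{m..}. of_real (w \<epsilon> n) * f n)"
  let ?s = "sigma \<epsilon> 1" and ?\<phi> = "\<lambda>n. complex_of_real (phi \<epsilon> n)"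
    and ?\<psi> = "\<lambda>n. complex_of_real (psi \<epsilon> n)" and ?w = "\<lambda>n. complex_of_real (w \<epsilon> n)"
  have s: "?s > 0" using sigma_pos[OF \<epsilon>] by simp
  have v: "of_real ?s * v m = ?\<psi> m * S m + ?\<phi> m * T m" for m
    unfolding v_def S_def T_def by (rule R_op_split[OF \<epsilon> sum])
  have S_Suc: "S (m + 1) = S m + (-1) ^ m * ?\<phi> m * f m" if "m \<ge> 1" for m
    using that by (simp add: S_def)
  have T_Suc: "T m = ?w m * f m + T (m + 1)" if "m \<ge> 1" for m
  proof -
    have "{m..} = {m} \<union> {m + 1..}" by auto
    hence "T m = (\<Sum>\<^sub>\<infinity>n\<in>{m} \<union> {m + 1..}. ?w n * f n)" by (simp only: T_def)
    also have "\<dots> = (\<Sum>\<^sub>\<infinity>n\<in>{m}. ?w n * f n) + T (m + 1)"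
      unfolding T_def
      by (intro infsum_Un_disjoint summable_on_subset_banach[OF sum, of "{m + 1..}"]) auto
    finally show ?thesis by simp
  qed
  have sgn: "(-1) ^ k * ((-1) ^ k * x) = x" for k :: nat and x :: complex
    by (simp flip: mult.assoc power_add mult_2)
  have prev: "of_real (real n - 1) * (of_real ?s * v (n - 1)) =
      of_real (real n - 1) * (?\<psi> (n - 1) * S n + ?\<phi> (n - 1) * T n)"
  proof (cases "n = 1")
    case False
    with n obtain m where m: "n = m + 1" "m \<ge> 1" by (cases n) auto
    have "of_real ?s * v m = ?\<psi> m * S n + ?\<phi> m * T n"
      unfolding v m(1) S_Suc[OF m(2)] T_Suc[OF m(2)] psi_eq_w
      by (simp add: algebra_simps sgn)
    thus ?thesis by (simp add: m)
  qed simp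
  have succ: "of_real ?s * v (n + 1) = ?\<psi> (n + 1) * S n + ?\<phi> (n + 1) * T n
      - (?\<phi> (n + 1) * ?w n + ?\<phi> n * ?w (n + 1)) * f n"
  proof -
    have "?\<psi> (n + 1) = - ((-1) ^ n * ?w (n + 1))" by (simp add: psi_eq_w)
    thus ?thesis
      unfolding v S_Suc[OF n] T_Suc[OF n] by (simp add: algebra_simps sgn)
  qed
  have rec: "(real n + 1) * psi \<epsilon> (n + 1) = (real n - 1) * psi \<epsilon> (n - 1) + 2 / \<epsilon> * psi \<epsilon> n" if "n \<noteq> 1"
    using solves_psi[OF \<epsilon>] that n unfolding solves_recurrence_iff by simp
  have \<psi>: "(of_real (real n - 1) * ?\<psi> (n - 1) - of_real (real n + 1) * ?\<psi> (n + 1)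
             + of_real (2 / \<epsilon>) * ?\<psi> n) * S n = 0"
  proof (cases "n = 1")
    case False
    with rec have "complex_of_real ((real n - 1) * psi \<epsilon> (n - 1) - (real n + 1) * psi \<epsilon> (n + 1)
                     + 2 / \<epsilon> * psi \<epsilon> n) = 0"
      by simp
    thus ?thesis by (simp only: of_real_add of_real_diff of_real_mult mult_zero_left)
  qed (simp add: S_def)
  have \<phi>: "of_real (real n - 1) * ?\<phi> (n - 1) - of_real (real n + 1) * ?\<phi> (n + 1)
             + of_real (2 / \<epsilon>) * ?\<phi> n = 0"
  proof -
    have "complex_of_real ((real n - 1) * phi \<epsilon> (n - 1) - (real n + 1) * phi \<epsilon> (n + 1)
            + 2 / \<epsilon> * phi \<epsilon> n) = 0"
      using phi_recurrence[OF n, of \<epsilon>] by simp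
    thus ?thesis by (simp only: of_real_add of_real_diff of_real_mult)
  qed
  have regroup: "a * (p * x + q * y) - b * (p' * x + q' * y - d * z) + c * (p'' * x + q'' * y) =
      (a * p - b * p' + c * p'') * x + (a * q - b * q' + c * q'') * y + b * d * z"
    for a b c d p p' p'' q q' q'' x y z :: complex
    by (simp add: algebra_simps)
  have "of_real ?s * A_plus \<epsilon> v n = of_real (\<epsilon> / 2) * of_nat n *
    (of_real (real n - 1) * (of_real ?s * v (n - 1)) - of_real (real n + 1) * (of_real ?s * v (n + 1))
     + of_real (2 / \<epsilon>) * (of_real ?s * v n))"
    using \<epsilon> by (simp only: A_plus_eq) (simp add: algebra_simps)
  also have "\<dots> = of_real (\<epsilon> / 2) * of_nat n *
     ((of_real (real n - 1) * ?\<psi> (n - 1) - of_real (real n + 1) * ?\<psi> (n + 1)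
             + of_real (2 / \<epsilon>) * ?\<psi> n) * S n +
      (of_real (real n - 1) * ?\<phi> (n - 1) - of_real (real n + 1) * ?\<phi> (n + 1)
             + of_real (2 / \<epsilon>) * ?\<phi> n) * T n +
      of_real (real n + 1) * (?\<phi> (n + 1) * ?w n + ?\<phi> n * ?w (n + 1)) * f n)"
    unfolding prev succ v[of n] regroup ..
  also have "\<dots> = of_real (\<epsilon> / 2 * real n * (real n + 1) *
      (phi \<epsilon> (n + 1) * w \<epsilon> n + phi \<epsilon> n * w \<epsilon> (n + 1))) * f n"
    unfolding \<psi> \<phi> by (simp add: mult_ac)
  also have "\<dots> = of_real ?s * f n"
    unfolding sigma_eq[OF \<epsilon> n, symmetric] sigma_constant[OF \<epsilon> n] ..
  finally show ?thesis using s by (simp add: v_def)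
qed

lemma square_summable_inverse_nat: "(\<lambda>n. (1 / real n)\<^sup>2) summable_on {1..}"
proof -
  have "(\<lambda>n. (1 / real n)\<^sup>2) summable_on UNIV"
    using inverse_power_summable[of 2, where 'a = real]
    by (subst summable_on_UNIV_nonneg_real_iff) (simp_all add: power_divide field_simps)
  thus ?thesis by (rule summable_on_subset) auto
qed

theorem theorem10:
  fixes \<epsilon> :: real
  assumes "0 < \<epsilon>" and "\<epsilon> < 2"
  shows "(\<lambda>(m, n). complex_of_real (rho \<epsilon> m n)) \<in> ell2 (Zpos \<times> Zpos) \<and>
    (\<forall>f\<in>ell2 Zpos. \<forall>m\<in>Zpos. (\<lambda>n. cmod (complex_of_real (rho \<epsilon> m n) * f n)) summable_on Zpos) \<and>
    hilbert_schmidt Zpos (R_op \<epsilon>) \<and>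
    (\<forall>f\<in>ell2 Zpos. R_op \<epsilon> f \<in> A_plus_dom \<epsilon> \<and> A_plus \<epsilon> (R_op \<epsilon> f) = f) \<and>
    0 \<notin> op_spectrum Zpos (A_plus_dom \<epsilon>) (A_plus \<epsilon>) \<and>
    is_inverse_op Zpos (A_plus_dom \<epsilon>) (A_plus \<epsilon>) (R_op \<epsilon>)"
proof -
  note \<epsilon> = assms
  let ?k = "\<lambda>m n. complex_of_real (rho \<epsilon> m n)"
  obtain C where C: "C > 0" "\<And>m n. m \<ge> 1 \<Longrightarrow> n \<ge> 1 \<Longrightarrow> \<bar>rho \<epsilon> m n\<bar> \<le> C / (real m * real n)"
    using abs_rho_le[OF \<epsilon>(1)] by metis
  have g: "(\<lambda>m. (C / real m)\<^sup>2) summable_on Zpos"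
    using summable_on_cmult_right[OF square_summable_inverse_nat, of "C\<^sup>2"]
    by (simp add: power_divide)
  have dom: "cmod (?k m n) \<le> C / real m * (1 / real n)" if "m \<in> Zpos" "n \<in> Zpos" for m n
    using C(2)[of m n] that by simp
  have nonneg: "C / real m \<ge> 0" for m using C(1) by simp
  note dominated = g square_summable_inverse_nat nonneg dom

  have rho_0: "rho \<epsilon> m n = 0" if "m = 0 \<or> n = 0" for m n
    using that by (auto simp: rho_def phi_0 psi_0[OF \<epsilon>(1)])
  have ell2: "(\<lambda>(m, n). ?k m n) \<in> ell2 (Zpos \<times> Zpos)"
    using dominated_kernel_square_summable[OF dominated]
    by (auto simp: ell2_def case_prod_unfold not_le intro: rho_0)
  have summable: "(\<lambda>n. cmod (?k m n * f n)) summable_on Zpos" if "f \<in> ell2 Zpos" "m \<in> Zpos" for f m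
    using dominated_kernel_abs_summable[OF dominated] that by auto
  have HS: "hilbert_schmidt Zpos (R_op \<epsilon>)"
    unfolding R_op_def using dominated_kernel_hilbert_schmidt[OF dominated] by auto
  hence bounded: "bounded_op Zpos (R_op \<epsilon>)" by (simp add: hilbert_schmidt_def)

  (* As phi 1 = 1, absolute convergence of the first row of the kernel gives that of the sum of w f. *)
  have right: "A_plus \<epsilon> (R_op \<epsilon> f) = f" if f: "f \<in> ell2 Zpos" for f
  proof -
    have "(\<lambda>n. ?k 1 n * f n) summable_on Zpos"
      by (rule abs_summable_summable, rule summable[OF f]) simp
    hence "(\<lambda>n. of_real (sigma \<epsilon> 1) * (?k 1 n * f n)) summable_on Zpos"
      by (rule summable_on_cmult_right)
    also have "?this \<longleftrightarrow> (\<lambda>n. of_real (w \<epsilon> n) * f n) summable_on Zpos"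
    proof (rule summable_on_cong)
      fix n :: nat assume n: "n \<in> Zpos"
      thus "of_real (sigma \<epsilon> 1) * (?k 1 n * f n) = of_real (w \<epsilon> n) * f n"
        using sigma_pos[OF \<epsilon>(1), of 1] phi_1[of \<epsilon>]
        by (simp add: rho_def w_def sigma_constant[OF \<epsilon>(1), of n])
    qed
    finally show ?thesis using A_plus_R_op[OF \<epsilon>(1)] f by (auto simp: ell2_def)
  qed
  have R_dom: "R_op \<epsilon> f \<in> A_plus_dom \<epsilon>" if "f \<in> ell2 Zpos" for f
    using that bounded by (simp add: A_plus_dom_def right bounded_op_def)
  (* R A v and v have the same image under A, so they differ by a multiple of phi, which must be 0. *)
  have left: "R_op \<epsilon> (A_plus \<epsilon> v) = v" if v: "v \<in> A_plus_dom \<epsilon>" for v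
  proof -
    let ?u = "R_op \<epsilon> (A_plus \<epsilon> v)"
    have Av: "v \<in> ell2 Zpos" "A_plus \<epsilon> v \<in> ell2 Zpos" using v by (auto simp: A_plus_dom_def)
    define d where "d = (\<lambda>n. ?u n + (-1) * v n)"
    have d: "d \<in> ell2 Zpos"
      unfolding d_def using R_dom[OF Av(2)] Av by (intro ell2_lincomb) (auto simp: A_plus_dom_def)
    have "A_plus \<epsilon> d n = 0" for n
      unfolding d_def A_plus_lincomb right[OF Av(2)] by simp
    moreover have "d 0 = 0" using d by (simp add: ell2_def)
    ultimately have d_eq: "d n = d 1 * of_real (phi \<epsilon> n)" for n
      by (intro A_plus_kernel[OF \<epsilon>(1)])
    have "d 1 = 0"
    proof (rule ccontr)
      assume d1: "d 1 \<noteq> 0"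
      have "(\<lambda>n. (cmod (d n))\<^sup>2) = (\<lambda>n. (cmod (d 1))\<^sup>2 * (phi \<epsilon> n)\<^sup>2)"
        by (subst d_eq) (simp add: norm_mult power_mult_distrib)
      with ell2_square_summable[OF d] d1 have "(\<lambda>n. (phi \<epsilon> n)\<^sup>2) summable_on Zpos"
        by (simp add: summable_on_cmult_right')
      thus False using phi_not_square_summable[OF \<epsilon>] by blast
    qed
    hence "d n = 0" for n using d_eq[of n] by simp
    thus ?thesis by (auto simp: d_def fun_eq_iff)
  qed
  have inverse: "is_inverse_op Zpos (A_plus_dom \<epsilon>) (A_plus \<epsilon>) (R_op \<epsilon>)"
    using left right R_dom by (auto simp: is_inverse_op_def A_plus_dom_def)
  hence "0 \<notin> op_spectrum Zpos (A_plus_dom \<epsilon>) (A_plus \<epsilon>)"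
    using bounded by (auto simp: op_spectrum_def)
  thus ?thesis using ell2 summable HS R_dom right inverse by blast
qed

end
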